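(* Let $\mathcal{H}$ be a complex separable Hilbert space, let $A\in\mathcal{B}(\mathcal{H})$ be a normal operator, let $\mathcal{G}\subset\mathcal{H}$ be a countable set of vectors, and let $0<L<\infty$. Let $\mu_\infty,\mu_1,\mu_2,\ldots$ be the measures in the spectral (multiplicity) representation of $A$ via a unitary $U$, and write $\tilde g=Ug=(\tilde g_j)_{1\le j\le\infty}$. (1) If $\{A^tg\}_{g\in\mathcal{G},\,t\in[0,L]}$ is complete in $\mathcal{H}$, then for every $1\le j\le\infty$ and $\mu_j$-a.e. $z$, the system of vectors $\{\tilde g_j(z)\}_{g\in\mathcal{G}}$ is complete in $\ell^2(\Omega_j)$. (2) If $A$ is also reductive, then $\{A^tg\}_{g\in\mathcal{G},\,t\in[0,L]}$ is complete in $\mathcal{H}$ if and only if for every $1\le j\le\infty$ the system $\{\tilde g_j(z)\}_{g\in\mathcal{G}}$ is complete in $\ell^2(\Omega_j)$ for $\mu_j$-a.e. $z$.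
   Context: A system of vectors is complete in a Hilbert space if its closed linear span is the whole space. Spectral theorem with multiplicity: for a normal operator $A$ on $\mathcal{H}$ there are mutually singular non-negative Borel measures $\mu_j$, $1\le j\le\infty$, on $\mathbb{C}$ and a unitary $U:\mathcal{H}\to\mathcal{W}=(L^2(\mu_\infty))^{(\infty)}\oplus L^2(\mu_1)\oplus(L^2(\mu_2))^{(2)}\oplus\cdots$ with $UAU^{-1}=N_{\mu_\infty}^{(\infty)}\oplus N_{\mu_1}\oplus N_{\mu_2}^{(2)}\oplus\cdots$. Here $N_\mu$ is the multiplication operator $N_\mu f(z)=zf(z)$ on $L^2(\mu)$, and the superscript $(k)$ denotes the direct sum of $k$ copies. The $\mu_j$ are supported on mutually disjoint Borel sets $\mathcal{E}_j$, and $\mu=\sum_{1\le j\le\infty}\mu_j$. $\Omega_j=\{1,\dots,j\}$ for $j\in\mathbb{N}$ and $\Omega_\infty=\mathbb{N}$. For $g\in\mathcal{H}$, $\tilde g=Ug=(\tilde g_j)_j$ where $\tilde g_j\in(L^2(\mu_j))^{(j)}$ is viewed as a function from $\mathbb{C}$ to $\ell^2(\Omega_j)$. Powers: $\langle A^tf_1,f_2\rangle=\int_{\sigma(A)}z^t\langle\tilde f_1(z),\tilde f_2(z)\rangle\,d\mu(z)$ for all $f_1,f_2\in\mathcal{H}$, where $\langle\tilde f_1(z),\tilde f_2(z)\rangle=\sum_{1\le j\le\infty}\chi_{\mathcal{E}_j}(z)\langle(\tilde f_1)_j(z),(\tilde f_2)_j(z)\rangle_{\ell^2(\Omega_j)}$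 and $z^t=\exp(t(\ln|z|+i\arg z))$ with $\arg z\in[-\pi,\pi)$ for $z\ne0$; $0^t=0$ for $t>0$ and $0^0=1$ (so $A^0=I$). An operator $A$ is reductive if every closed invariant subspace $V$ of $A$ is reducing, i.e. both $V$ and $V^\perp$ are invariant under $A$. *)

theory Defs
  imports "HOL-Analysis.Analysis"
begin

section \<open>Complex Hilbert spaces\<close>

text \<open>
  The real structure, the norm and the topology are inherited from \<^class>\<open>real_inner\<close>; the
  complex inner product is linear in its first argument, and its real part is the real
  inner product (so that the norm of x is the square root of its inner product with itself).
\<close>

class scaleC =
  fixes scaleC :: "complex \<Rightarrow> 'a \<Rightarrow> 'a"  (infixr \<open>*\<^sub>C\<close> 75)

class complex_inner = real_inner + scaleC +
  fixes cinner :: "'a \<Rightarrow> 'a \<Rightarrow> complex"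
  assumes scaleC_add_right: "c *\<^sub>C (x + y) = c *\<^sub>C x + c *\<^sub>C y"
    and scaleC_add_left: "(c + d) *\<^sub>C x = c *\<^sub>C x + d *\<^sub>C x"
    and scaleC_scaleC: "c *\<^sub>C d *\<^sub>C x = (c * d) *\<^sub>C x"
    and scaleC_of_real: "complex_of_real r *\<^sub>C x = r *\<^sub>R x"
    and cinner_commute: "cinner x y = cnj (cinner y x)"
    and cinner_add_left: "cinner (x + y) z = cinner x z + cinner y z"
    and cinner_scaleC_left: "cinner (c *\<^sub>C x) y = c * cinner x y"
    and Re_cinner: "Re (cinner x y) = inner x y"

class chilbert_space = complex_inner + complete_space

global_interpretation complex_vector: vector_space "scaleC :: complex \<Rightarrow> 'a \<Rightarrow> 'a::complex_inner"
  defines csubspace = complex_vector.subspace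
    and cspan = complex_vector.span
proof unfold_locales
  show "1 *\<^sub>C x = x" for x :: 'a
    using scaleC_of_real[of 1 x] by simp
qed (simp_all add: scaleC_add_right scaleC_add_left scaleC_scaleC)

definition complete_system :: "'a::complex_inner set \<Rightarrow> 'a set \<Rightarrow> bool" where
  "complete_system S V \<longleftrightarrow> closure (cspan S) = V"

definition bounded_clinear :: "('a::complex_inner \<Rightarrow> 'b::complex_inner) \<Rightarrow> bool" where
  "bounded_clinear A \<longleftrightarrow> bounded_linear A \<and> (\<forall>c x. A (c *\<^sub>C x) = c *\<^sub>C A x)"

definition cadjoint :: "('a::complex_inner \<Rightarrow> 'a) \<Rightarrow> 'a \<Rightarrow> 'a" where
  "cadjoint A = (THE B. \<forall>x y. cinner (A x) y = cinner x (B y))"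

definition normal_operator :: "('a::chilbert_space \<Rightarrow> 'a) \<Rightarrow> bool" where
  "normal_operator A \<longleftrightarrow> bounded_clinear A \<and> A \<circ> cadjoint A = cadjoint A \<circ> A"

definition spectrum :: "('a::chilbert_space \<Rightarrow> 'a) \<Rightarrow> complex set" where
  "spectrum A = {w. \<not> (\<exists>B. bounded_clinear B \<and>
     (\<forall>x. B (A x - w *\<^sub>C x) = x) \<and> (\<forall>x. A (B x) - w *\<^sub>C B x = x))}"

definition orth_complement :: "'a::complex_inner set \<Rightarrow> 'a set" where
  "orth_complement V = {x. \<forall>v\<in>V. cinner x v = 0}"

definition invariant_subspace :: "('a::chilbert_space \<Rightarrow> 'a) \<Rightarrow> 'a set \<Rightarrow> bool" where
  "invariant_subspace A V \<longleftrightarrow> csubspace V \<and> A ` V \<subseteq> V"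

definition reducing_subspace :: "('a::chilbert_space \<Rightarrow> 'a) \<Rightarrow> 'a set \<Rightarrow> bool" where
  "reducing_subspace A V \<longleftrightarrow> invariant_subspace A V \<and> invariant_subspace A (orth_complement V)"

definition reductive :: "('a::chilbert_space \<Rightarrow> 'a) \<Rightarrow> bool" where
  "reductive A \<longleftrightarrow> (\<forall>V. closed V \<and> invariant_subspace A V \<longrightarrow> reducing_subspace A V)"


section \<open>Square-summable sequences\<close>

typedef ell2 = "{x :: nat \<Rightarrow> complex. summable (\<lambda>k. (cmod (x k))\<^sup>2)}"
  morphisms coord Abs_ell2
  by (rule exI[of _ "\<lambda>_. 0"]) simp

setup_lifting type_definition_ell2

lemma coord_summable: "summable (\<lambda>k. (cmod (coord x k))\<^sup>2)"
  using coord[of x] by simp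

lemma square_summable_add:
  fixes x y :: "nat \<Rightarrow> complex"
  assumes "summable (\<lambda>k. (cmod (x k))\<^sup>2)" "summable (\<lambda>k. (cmod (y k))\<^sup>2)"
  shows "summable (\<lambda>k. (cmod (x k + y k))\<^sup>2)"
proof (rule summable_comparison_test')
  show "summable (\<lambda>k. 2 * (cmod (x k))\<^sup>2 + 2 * (cmod (y k))\<^sup>2)"
    by (intro summable_add summable_mult assms)
  show "norm ((cmod (x k + y k))\<^sup>2) \<le> 2 * (cmod (x k))\<^sup>2 + 2 * (cmod (y k))\<^sup>2" for k
  proof -
    have "(cmod (x k + y k))\<^sup>2 \<le> (cmod (x k) + cmod (y k))\<^sup>2"
      by (intro power_mono norm_triangle_ineq) auto
    also have "\<dots> \<le> 2 * (cmod (x k))\<^sup>2 + 2 * (cmod (y k))\<^sup>2"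
      using sum_squares_bound[of "cmod (x k)" "cmod (y k)"] by (simp add: power2_sum)
    finally show ?thesis by simp
  qed
qed

lemma square_summable_mult:
  fixes x y :: "nat \<Rightarrow> complex"
  assumes "summable (\<lambda>k. (cmod (x k))\<^sup>2)" "summable (\<lambda>k. (cmod (y k))\<^sup>2)"
  shows "summable (\<lambda>k. cmod (x k * cnj (y k)))"
proof (rule summable_comparison_test')
  show "summable (\<lambda>k. (cmod (x k))\<^sup>2 + (cmod (y k))\<^sup>2)"
    by (intro summable_add assms)
  show "norm (cmod (x k * cnj (y k))) \<le> (cmod (x k))\<^sup>2 + (cmod (y k))\<^sup>2" for k
  proof -
    have "2 * (cmod (x k) * cmod (y k)) \<le> (cmod (x k))\<^sup>2 + (cmod (y k))\<^sup>2"
      using sum_squares_bound[of "cmod (x k)" "cmod (y k)"] by simp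
    moreover have "0 \<le> cmod (x k) * cmod (y k)" by simp
    ultimately have "cmod (x k) * cmod (y k) \<le> (cmod (x k))\<^sup>2 + (cmod (y k))\<^sup>2" by linarith
    then show ?thesis by (simp add: norm_mult)
  qed
qed

instantiation ell2 :: complex_inner
begin

lift_definition zero_ell2 :: ell2 is "\<lambda>_. 0" by simp
lift_definition plus_ell2 :: "ell2 \<Rightarrow> ell2 \<Rightarrow> ell2" is "\<lambda>x y k. x k + y k"
  by (rule square_summable_add)
lift_definition uminus_ell2 :: "ell2 \<Rightarrow> ell2" is "\<lambda>x k. - x k" by simp
lift_definition minus_ell2 :: "ell2 \<Rightarrow> ell2 \<Rightarrow> ell2" is "\<lambda>x y k. x k - y k"
  subgoal for x y using square_summable_add[of x "\<lambda>k. - y k"] by simp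
  done
lift_definition scaleR_ell2 :: "real \<Rightarrow> ell2 \<Rightarrow> ell2" is "\<lambda>r x k. r *\<^sub>R x k"
  by (simp add: power_mult_distrib summable_mult)
lift_definition scaleC_ell2 :: "complex \<Rightarrow> ell2 \<Rightarrow> ell2" is "\<lambda>c x k. c * x k"
  by (simp add: norm_mult power_mult_distrib summable_mult)

definition cinner_ell2 :: "ell2 \<Rightarrow> ell2 \<Rightarrow> complex" where
  "cinner_ell2 x y = (\<Sum>k. coord x k * cnj (coord y k))"
definition inner_ell2 :: "ell2 \<Rightarrow> ell2 \<Rightarrow> real" where
  "inner_ell2 x y = Re (cinner x y)"
definition norm_ell2 :: "ell2 \<Rightarrow> real" where
  "norm_ell2 x = sqrt (inner x x)"
definition sgn_ell2 :: "ell2 \<Rightarrow> ell2" where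
  "sgn_ell2 x = inverse (norm x) *\<^sub>R x"
definition dist_ell2 :: "ell2 \<Rightarrow> ell2 \<Rightarrow> real" where
  "dist_ell2 x y = norm (x - y)"
definition uniformity_ell2 :: "(ell2 \<times> ell2) filter" where
  "uniformity_ell2 = (INF e\<in>{0 <..}. principal {(x, y). dist x y < e})"
definition open_ell2 :: "ell2 set \<Rightarrow> bool" where
  "open_ell2 S = (\<forall>x\<in>S. \<forall>\<^sub>F (x', y) in uniformity. x' = x \<longrightarrow> y \<in> S)"

instance
proof
  have summ: "summable (\<lambda>k. coord x k * cnj (coord y k))" for x y :: ell2
    by (rule summable_norm_cancel) (intro square_summable_mult coord_summable)
  fix x y z :: ell2 and a b :: real and c d :: complex
  show "x + y + z = x + (y + z)" "x + y = y + x" "0 + x = x" "- x + x = 0" "x - y = x + - y"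
    by (transfer, simp add: algebra_simps)+
  show "a *\<^sub>R (x + y) = a *\<^sub>R x + a *\<^sub>R y" "(a + b) *\<^sub>R x = a *\<^sub>R x + b *\<^sub>R x"
    "a *\<^sub>R b *\<^sub>R x = (a * b) *\<^sub>R x" "1 *\<^sub>R x = x"
    by (transfer, simp add: algebra_simps)+
  show "c *\<^sub>C (x + y) = c *\<^sub>C x + c *\<^sub>C y" "(c + d) *\<^sub>C x = c *\<^sub>C x + d *\<^sub>C x"
    "c *\<^sub>C d *\<^sub>C x = (c * d) *\<^sub>C x"
    by (transfer, simp add: algebra_simps)+
  show "complex_of_real a *\<^sub>C x = a *\<^sub>R x"
    by transfer (simp add: scaleR_conv_of_real)
  show comm: "cinner x y = cnj (cinner y x)"
    unfolding cinner_ell2_def bounded_linear.suminf[OF bounded_linear_cnj summ]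
    by (simp add: mult.commute)
  show add: "cinner (x + y) z = cinner x z + cinner y z"
    unfolding cinner_ell2_def
    by (simp add: plus_ell2.rep_eq ring_distribs suminf_add[OF summ summ])
  show scal: "cinner (c *\<^sub>C x) y = c * cinner x y"
    unfolding cinner_ell2_def
    by (simp add: scaleC_ell2.rep_eq mult.assoc suminf_mult[OF summ])
  show "Re (cinner x y) = inner x y" by (simp add: inner_ell2_def)
  show "inner x y = inner y x" unfolding inner_ell2_def comm by simp
  show "inner (x + y) z = inner x z + inner y z" by (simp add: inner_ell2_def add)
  show "inner (a *\<^sub>R x) y = a * inner x y"
  proof -
    have "a *\<^sub>R x = complex_of_real a *\<^sub>C x" by transfer (simp add: scaleR_conv_of_real)
    then show ?thesis
      unfolding inner_ell2_def cinner_ell2_def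
      by (simp add: scaleC_ell2.rep_eq mult.assoc suminf_mult[OF summ])
  qed
  have inner_self: "inner x x = (\<Sum>k. (cmod (coord x k))\<^sup>2)"
  proof -
    have "cinner x x = (\<Sum>k. complex_of_real ((cmod (coord x k))\<^sup>2))"
      unfolding cinner_ell2_def by (simp only: complex_norm_square)
    also have "\<dots> = complex_of_real (\<Sum>k. (cmod (coord x k))\<^sup>2)"
      by (rule suminf_of_real[OF coord_summable, symmetric])
    finally show ?thesis by (simp add: inner_ell2_def)
  qed
  show "0 \<le> inner x x" unfolding inner_self by (rule suminf_nonneg[OF coord_summable]) simp
  show "inner x x = 0 \<longleftrightarrow> x = 0"
    unfolding inner_self using suminf_eq_zero_iff[OF coord_summable[of x]]
    by (simp add: coord_inject[symmetric] zero_ell2.rep_eq fun_eq_iff)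
qed (simp_all add: norm_ell2_def sgn_ell2_def dist_ell2_def uniformity_ell2_def open_ell2_def)

end

lemma norm_ell2_power2: "(norm x)\<^sup>2 = (\<Sum>k. (cmod (coord x k))\<^sup>2)"
proof -
  have "cinner x x = (\<Sum>k. complex_of_real ((cmod (coord x k))\<^sup>2))"
    unfolding cinner_ell2_def by (simp only: complex_norm_square)
  also have "\<dots> = complex_of_real (\<Sum>k. (cmod (coord x k))\<^sup>2)"
    by (rule suminf_of_real[OF coord_summable, symmetric])
  finally show ?thesis by (simp add: power2_norm_eq_inner inner_ell2_def)
qed

lemma norm_coord_le: "cmod (coord x k) \<le> norm x"
proof -
  have "(\<Sum>i\<in>{k}. (cmod (coord x i))\<^sup>2) \<le> (norm x)\<^sup>2"
    unfolding norm_ell2_power2 by (rule sum_le_suminf[OF coord_summable]) auto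
  then have "(cmod (coord x k))\<^sup>2 \<le> (norm x)\<^sup>2" by simp
  then show ?thesis by (rule power2_le_imp_le) simp
qed

instance ell2 :: chilbert_space
proof
  fix X :: "nat \<Rightarrow> ell2"
  assume "Cauchy X"
  have "Cauchy (\<lambda>n. coord (X n) k)" for k
    unfolding Cauchy_iff
  proof (intro allI impI)
    fix e :: real assume "e > 0"
    then obtain M where M: "\<And>m n. m \<ge> M \<Longrightarrow> n \<ge> M \<Longrightarrow> norm (X m - X n) < e"
      using \<open>Cauchy X\<close> unfolding Cauchy_iff by blast
    have "norm (coord (X m) k - coord (X n) k) < e" if "m \<ge> M" "n \<ge> M" for m n
      using norm_coord_le[of "X m - X n" k] M[OF that] by (simp add: minus_ell2.rep_eq)
    then show "\<exists>M. \<forall>m\<ge>M. \<forall>n\<ge>M. norm (coord (X m) k - coord (X n) k) < e" by blast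
  qed
  then have "\<forall>k. \<exists>l. (\<lambda>n. coord (X n) k) \<longlonglongrightarrow> l"
    using Cauchy_convergent unfolding convergent_def by blast
  then obtain y where y: "\<And>k. (\<lambda>n. coord (X n) k) \<longlonglongrightarrow> y k" by metis
  have est: "\<exists>M. \<forall>m\<ge>M. summable (\<lambda>k. (cmod (coord (X m) k - y k))\<^sup>2) \<and>
      (\<Sum>k. (cmod (coord (X m) k - y k))\<^sup>2) \<le> e\<^sup>2" if "e > 0" for e :: real
  proof -
    obtain M where M: "\<And>m n. m \<ge> M \<Longrightarrow> n \<ge> M \<Longrightarrow> norm (X m - X n) < e"
      using \<open>Cauchy X\<close> \<open>e > 0\<close> unfolding Cauchy_iff by blast
    have part: "(\<Sum>k<K. (cmod (coord (X m) k - y k))\<^sup>2) \<le> e\<^sup>2" if "m \<ge> M" for m K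
    proof (rule LIMSEQ_le_const2)
      show "(\<lambda>n. \<Sum>k<K. (cmod (coord (X m) k - coord (X n) k))\<^sup>2)
          \<longlonglongrightarrow> (\<Sum>k<K. (cmod (coord (X m) k - y k))\<^sup>2)"
        by (intro tendsto_intros y)
      have "(\<Sum>k<K. (cmod (coord (X m) k - coord (X n) k))\<^sup>2) \<le> e\<^sup>2" if "n \<ge> M" for n
      proof -
        have "(\<Sum>k<K. (cmod (coord (X m - X n) k))\<^sup>2) \<le> (norm (X m - X n))\<^sup>2"
          unfolding norm_ell2_power2 by (rule sum_le_suminf[OF coord_summable]) auto
        also have "\<dots> \<le> e\<^sup>2"
          using M[OF \<open>m \<ge> M\<close> that] by (intro power_mono) auto
        finally show ?thesis by (simp add: minus_ell2.rep_eq)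
      qed
      then show "\<exists>N. \<forall>n\<ge>N. (\<Sum>k<K. (cmod (coord (X m) k - coord (X n) k))\<^sup>2) \<le> e\<^sup>2" by blast
    qed
    have "summable (\<lambda>k. (cmod (coord (X m) k - y k))\<^sup>2) \<and>
      (\<Sum>k. (cmod (coord (X m) k - y k))\<^sup>2) \<le> e\<^sup>2" if "m \<ge> M" for m
    proof -
      have "summable (\<lambda>k. (cmod (coord (X m) k - y k))\<^sup>2)"
        by (rule summableI_nonneg_bounded[where x = "e\<^sup>2"]) (use part[OF that] in auto)
      then show ?thesis using part[OF that] by (auto intro: suminf_le_const)
    qed
    then show ?thesis by blast
  qed
  obtain M1 where M1: "summable (\<lambda>k. (cmod (coord (X M1) k - y k))\<^sup>2)"
    using est[of 1] by auto
  have "summable (\<lambda>k. (cmod (coord (X M1) k + - (coord (X M1) k - y k)))\<^sup>2)"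
    by (rule square_summable_add[OF coord_summable]) (use M1 in \<open>simp add: norm_minus_commute\<close>)
  then have Y: "coord (Abs_ell2 y) = y" by (simp add: Abs_ell2_inverse)
  have "X \<longlonglongrightarrow> Abs_ell2 y"
    unfolding LIMSEQ_iff
  proof (intro allI impI)
    fix r :: real assume "r > 0"
    then obtain M where M: "\<forall>m\<ge>M. (\<Sum>k. (cmod (coord (X m) k - y k))\<^sup>2) \<le> (r/2)\<^sup>2"
      using est[of "r/2"] by auto
    have "norm (X m - Abs_ell2 y) < r" if "m \<ge> M" for m
    proof -
      have "(norm (X m - Abs_ell2 y))\<^sup>2 \<le> (r/2)\<^sup>2"
        using M that by (simp add: norm_ell2_power2 minus_ell2.rep_eq Y)
      then have "norm (X m - Abs_ell2 y) \<le> r/2"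
        by (rule power2_le_imp_le) (use \<open>r > 0\<close> in simp)
      then show ?thesis using \<open>r > 0\<close> by simp
    qed
    then show "\<exists>no. \<forall>n\<ge>no. norm (X n - Abs_ell2 y) < r" by blast
  qed
  then show "convergent X" by (rule convergentI)
qed

definition ell2_on :: "nat set \<Rightarrow> ell2 set" where
  "ell2_on I = {x. \<forall>k. k \<notin> I \<longrightarrow> coord x k = 0}"


section \<open>The spectral representation with multiplicity\<close>

text \<open>The indices of the family of measures range over \<open>{1..} :: enat set\<close>.\<close>

definition Omega :: "enat \<Rightarrow> nat set" where
  "Omega j = {k. 1 \<le> k \<and> enat k \<le> j}"

text \<open>
  An element of the direct sum of the \<open>j\<close>-fold sums of \<open>L\<^sup>2(\<mu> j)\<close> is represented by a family of
  functions \<open>F j\<close> from the complex plane to \<open>\<ell>\<^sup>2(\<Omega>\<^sub>j)\<close>; its component in the \<open>k\<close>-th copy of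
  \<open>L\<^sup>2(\<mu> j)\<close> is \<open>\<lambda>z. coord (F j z) k\<close>. The elements of \<open>dsum_L2\<close> are representatives: equality
  in the direct sum is \<open>dsum_eq\<close>.
\<close>

definition dsum_L2 :: "(enat \<Rightarrow> complex measure) \<Rightarrow> (enat \<Rightarrow> complex \<Rightarrow> ell2) set" where
  "dsum_L2 \<mu> = {F.
     (\<forall>j\<ge>1. \<forall>z. F j z \<in> ell2_on (Omega j)) \<and>
     (\<forall>j\<ge>1. \<forall>k\<in>Omega j. (\<lambda>z. coord (F j z) k) \<in> borel_measurable (\<mu> j) \<and>
        integrable (\<mu> j) (\<lambda>z. (cmod (coord (F j z) k))\<^sup>2)) \<and>
     (\<lambda>(j, k). LINT z|\<mu> j. (cmod (coord (F j z) k))\<^sup>2) summable_on (SIGMA j:{1..}. Omega j)}"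

definition dsum_eq ::
  "(enat \<Rightarrow> complex measure) \<Rightarrow> (enat \<Rightarrow> complex \<Rightarrow> ell2) \<Rightarrow> (enat \<Rightarrow> complex \<Rightarrow> ell2) \<Rightarrow> bool" where
  "dsum_eq \<mu> F G \<longleftrightarrow> (\<forall>j\<ge>1. AE z in \<mu> j. F j z = G j z)"

definition dsum_cinner ::
  "(enat \<Rightarrow> complex measure) \<Rightarrow> (enat \<Rightarrow> complex \<Rightarrow> ell2) \<Rightarrow> (enat \<Rightarrow> complex \<Rightarrow> ell2) \<Rightarrow> complex" where
  "dsum_cinner \<mu> F G =
     (\<Sum>\<^sub>\<infinity>(j, k)\<in>(SIGMA j:{1..}. Omega j). LINT z|\<mu> j. coord (F j z) k * cnj (coord (G j z) k))"

definition unitary_onto_dsum ::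
  "(enat \<Rightarrow> complex measure) \<Rightarrow> ('a::chilbert_space \<Rightarrow> enat \<Rightarrow> complex \<Rightarrow> ell2) \<Rightarrow> bool" where
  "unitary_onto_dsum \<mu> U \<longleftrightarrow>
     (\<forall>f. U f \<in> dsum_L2 \<mu>) \<and>
     (\<forall>f g. dsum_eq \<mu> (U (f + g)) (\<lambda>j z. U f j z + U g j z)) \<and>
     (\<forall>c f. dsum_eq \<mu> (U (c *\<^sub>C f)) (\<lambda>j z. c *\<^sub>C U f j z)) \<and>
     (\<forall>f g. dsum_cinner \<mu> (U f) (U g) = cinner f g) \<and>
     (\<forall>F\<in>dsum_L2 \<mu>. \<exists>f. dsum_eq \<mu> (U f) F)"

text \<open>
  \<open>\<mu> j\<close> is carried by \<open>E j\<close>, and the \<open>E j\<close> are disjoint, which makes the \<open>\<mu> j\<close> mutually singular.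
  Borel measures are taken to be sigma-finite: on an atom of infinite measure every
  square-integrable function vanishes, so the direct sum would not determine \<open>\<mu>\<close>.
\<close>

definition spectral_representation ::
  "('a::chilbert_space \<Rightarrow> 'a) \<Rightarrow> (enat \<Rightarrow> complex measure) \<Rightarrow> (enat \<Rightarrow> complex set)
    \<Rightarrow> ('a \<Rightarrow> enat \<Rightarrow> complex \<Rightarrow> ell2) \<Rightarrow> bool" where
  "spectral_representation A \<mu> E U \<longleftrightarrow>
     (\<forall>j\<ge>1. sets (\<mu> j) = sets borel \<and> sigma_finite_measure (\<mu> j)) \<and>
     (\<forall>j\<ge>1. E j \<in> sets borel \<and> emeasure (\<mu> j) (- E j) = 0) \<and>
     disjoint_family_on E {1..} \<and>
     unitary_onto_dsum \<mu> U \<and>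
     (\<forall>f. dsum_eq \<mu> (U (A f)) (\<lambda>j z. z *\<^sub>C U f j z))"


section \<open>Powers of a normal operator\<close>

definition sum_measure :: "(enat \<Rightarrow> complex measure) \<Rightarrow> complex measure" where
  "sum_measure \<mu> = measure_of UNIV (sets borel) (\<lambda>B. \<integral>\<^sup>+j. emeasure (\<mu> j) B \<partial>count_space {1..})"

lemma sets_sum_measure [measurable_cong]: "sets (sum_measure \<mu>) = sets borel"
  and space_sum_measure [simp]: "space (sum_measure \<mu>) = UNIV"
  using sets.sigma_sets_eq[of "borel :: complex measure"]
  by (auto simp only: sum_measure_def sets_measure_of space_measure_of space_borel subset_UNIV Pow_UNIV)

lemma emeasure_sum_measure:
  assumes "\<And>j. j \<ge> 1 \<Longrightarrow> sets (\<mu> j) = sets borel" and "B \<in> sets borel"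
  shows "emeasure (sum_measure \<mu>) B = (\<integral>\<^sup>+j. emeasure (\<mu> j) B \<partial>count_space {1..})"
proof (rule emeasure_measure_of[OF sum_measure_def])
  show "countably_additive (sets (sum_measure \<mu>))
      (\<lambda>B. \<integral>\<^sup>+j. emeasure (\<mu> j) B \<partial>count_space {1..})"
  proof (rule countably_additiveI)
    fix C :: "nat \<Rightarrow> complex set"
    assume C: "range C \<subseteq> sets (sum_measure \<mu>)" "disjoint_family C"
    have "(\<Sum>i. \<integral>\<^sup>+j. emeasure (\<mu> j) (C i) \<partial>count_space {1..})
        = (\<integral>\<^sup>+j. (\<Sum>i. emeasure (\<mu> j) (C i)) \<partial>count_space {1..})"
      by (rule nn_integral_suminf[symmetric]) simp
    also have "\<dots> = (\<integral>\<^sup>+j. emeasure (\<mu> j) (\<Union>i. C i) \<partial>count_space {1..})"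
      by (intro nn_integral_cong suminf_emeasure)
        (use C assms(1) in \<open>auto simp: sets_sum_measure\<close>)
    finally show "(\<Sum>i. \<integral>\<^sup>+j. emeasure (\<mu> j) (C i) \<partial>count_space {1..})
        = (\<integral>\<^sup>+j. emeasure (\<mu> j) (\<Union>i. C i) \<partial>count_space {1..})" .
  qed
qed (use assms in \<open>auto simp: sets_sum_measure positive_def\<close>)

text \<open>
  The branch of the argument with values in \<open>[-\<pi>, \<pi>)\<close>, whereas the library's \<^const>\<open>Arg\<close> takes
  values in \<open>(-\<pi>, \<pi>]\<close>.
\<close>

definition arg_branch :: "complex \<Rightarrow> real" where
  "arg_branch z = (if Arg z = pi then - pi else Arg z)"

definition zpow :: "complex \<Rightarrow> real \<Rightarrow> complex" where
  "zpow z t = (if z = 0 then (if t = 0 then 1 else 0)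
     else exp (complex_of_real t * Complex (ln (cmod z)) (arg_branch z)))"

definition fibre_cinner ::
  "(enat \<Rightarrow> complex set) \<Rightarrow> (enat \<Rightarrow> complex \<Rightarrow> ell2) \<Rightarrow> (enat \<Rightarrow> complex \<Rightarrow> ell2) \<Rightarrow> complex \<Rightarrow> complex" where
  "fibre_cinner E F G z = (\<Sum>\<^sub>\<infinity>j\<in>{1..}. indicator (E j) z * cinner (F j z) (G j z))"

definition operator_power ::
  "('a::chilbert_space \<Rightarrow> 'a) \<Rightarrow> (enat \<Rightarrow> complex measure) \<Rightarrow> (enat \<Rightarrow> complex set)
    \<Rightarrow> ('a \<Rightarrow> enat \<Rightarrow> complex \<Rightarrow> ell2) \<Rightarrow> real \<Rightarrow> 'a \<Rightarrow> 'a" where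
  "operator_power A \<mu> E U t = (THE B. bounded_clinear B \<and> (\<forall>f\<^sub>1 f\<^sub>2. cinner (B f\<^sub>1) f\<^sub>2 =
     (LINT z:spectrum A|sum_measure \<mu>. zpow z t * fibre_cinner E (U f\<^sub>1) (U f\<^sub>2) z)))"

end

theory Submission
  imports Defs "HOL-Complex_Analysis.Cauchy_Integral_Formula"
begin

text \<open>
  Completeness of the orbits passes to the fibres without any measurable selection: the vector
  of the direct sum whose fibre is a basis vector of \<open>\<ell>\<^sup>2(\<Omega>\<^sub>j)\<close> on a set of finite measure is a
  limit of combinations of the \<open>A\<^sup>t g\<close>; if these are chosen to converge fast, they converge in almost every
  fibre, and there the combinations lie in the span of the \<open>g\<^sub>j(z)\<close>.

  Conversely, let \<open>f\<close> be orthogonal to all \<open>A\<^sup>t g\<close> with \<open>t \<in> [0,L]\<close>, and let \<open>h(z) = \<langle>g(z), f(z)\<rangle>\<close>.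
  The integral of \<open>z\<^sup>t h\<close> is real-analytic in \<open>t > 0\<close>, so it vanishes for all \<open>t \<ge> 0\<close>, and \<open>f\<close> is
  orthogonal to the invariant subspace generated by the \<open>A\<^sup>n g\<close>. If \<open>A\<close> is reductive, all \<open>A\<^sup>m f\<close> are
  orthogonal to it as well, that is, every moment \<open>z\<^sup>n (cnj z)\<^sup>m\<close> of \<open>h\<close> vanishes. By the
  Stone-Weierstrass theorem \<open>h = 0\<close> almost everywhere, and completeness of the fibres gives \<open>f = 0\<close>.
\<close>

section \<open>Complex Hilbert spaces\<close>

text \<open>\<open>operator_power\<close> is given only through its sesquilinear form, integrated
  over \<open>spectrum A\<close>, and the spectrum is defined by invertibility. So the measures must
  first be tied to it: \<open>spectrum A\<close> is closed and bounded and carries every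
  \<open>\<mu> j\<close>. Then A^t is multiplication by z^t in the model, the cut-off to the
  spectrum is harmless, and t = n gives the iterates of A. Multiplicities are handled by passing to
  the single measure \<open>sum_measure \<mu>\<close>, of which \<open>\<mu> j\<close> is the
  restriction to \<open>E j\<close>; there h is one scalar integrable function with integral <g, f>.
  The point 0 shapes the continuation in t. Since 0^t = 0 for t > 0 but 0^0 = 1, an atom at 0 may
  make the integral jump at t = 0; only t > 0 is continued, and t = 0 is read off the hypothesis. As
  the logarithm is unbounded near 0, the expansion about t is guaranteed only within radius t, so
  the interval of vanishing has to be enlarged in steps. The factors cnj z that reductivity supplies
  are essential: the powers z^n alone do not separate measures on the plane.\<close>

lemma cinner_scaleC_right: "cinner x (c *\<^sub>C y) = cnj c * cinner x (y::'a::complex_inner)"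
  by (metis cinner_scaleC_left cinner_commute complex_cnj_mult)

lemma scaleC_minus1: "(- 1) *\<^sub>C x = - (x::'a::complex_inner)"
  using scaleC_of_real[of "- 1" x] by simp

lemma cinner_minus_left: "cinner (- x) y = - cinner x (y::'a::complex_inner)"
  by (metis cinner_scaleC_left mult_minus1 scaleC_minus1)

lemma cinner_diff_left: "cinner (x - y) z = cinner x z - cinner y (z::'a::complex_inner)"
  using cinner_add_left[of x "- y" z] by (simp add: cinner_minus_left)

lemma cinner_zero_left [simp]: "cinner 0 (y::'a::complex_inner) = 0"
  using cinner_diff_left[of y y y] by simp

lemma cinner_eq_zero_sym: "cinner x y = 0 \<longleftrightarrow> cinner y (x::'a::complex_inner) = 0"
  by (metis cinner_commute complex_cnj_zero)

lemma cinner_self: "cinner x x = complex_of_real ((norm (x::'a::complex_inner))\<^sup>2)"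
proof (rule complex_eqI)
  have "Im (cinner x x) = - Im (cinner x x)"
    by (metis cinner_commute cnj.sel(2))
  then show "Im (cinner x x) = Im (complex_of_real ((norm x)\<^sup>2))" by simp
qed (simp add: Re_cinner power2_norm_eq_inner)

lemma norm_scaleC: "norm (c *\<^sub>C x) = cmod c * norm (x::'a::complex_inner)"
proof -
  have "complex_of_real ((norm (c *\<^sub>C x))\<^sup>2) = complex_of_real ((cmod c * norm x)\<^sup>2)"
    unfolding cinner_self[symmetric] cinner_scaleC_left cinner_scaleC_right
    unfolding cinner_self power_mult_distrib of_real_mult complex_norm_square by simp
  then show ?thesis
    by (metis of_real_eq_iff norm_ge_zero power2_eq_iff_nonneg mult_nonneg_nonneg)
qed

lemma norm_cinner_le: "cmod (cinner x y) \<le> norm x * norm (y::'a::complex_inner)"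
proof (cases "cinner x y = 0")
  case False
  \<comment> \<open>The unit scalar \<open>u\<close> rotates the inner product onto the positive
    real axis, where the real Cauchy-Schwarz inequality applies to
    \<open>u *\<^sub>C x\<close>.\<close>
  define u where "u = cnj (cinner x y) / complex_of_real (cmod (cinner x y))"
  have "cmod (cinner x y) = Re (u * cinner x y)"
    using False by (simp add: u_def mult.commute complex_norm_square[symmetric] power2_eq_square)
  also have "\<dots> = inner (u *\<^sub>C x) y" by (simp add: Re_cinner[symmetric] cinner_scaleC_left)
  also have "\<dots> \<le> norm (u *\<^sub>C x) * norm y" by (rule norm_cauchy_schwarz)
  also have "norm (u *\<^sub>C x) = norm x"
    using False by (simp add: norm_scaleC u_def norm_divide)
  finally show ?thesis .
qed simp

lemma bounded_linear_cinner_left: "bounded_linear (\<lambda>x. cinner x (y::'a::complex_inner))"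
proof (rule bounded_linear_intro)
  show "cinner (r *\<^sub>R x) y = r *\<^sub>R cinner x y" for r x
    by (metis cinner_scaleC_left scaleC_of_real scaleR_conv_of_real)
  show "norm (cinner x y) \<le> norm x * norm y" for x by (rule norm_cinner_le)
qed (rule cinner_add_left)

lemma bounded_linear_scaleC: "bounded_linear (\<lambda>x. c *\<^sub>C (x::'a::complex_inner))"
proof (rule bounded_linear_intro)
  show "c *\<^sub>C r *\<^sub>R x = r *\<^sub>R c *\<^sub>C x" for r and x :: 'a
    by (simp add: scaleC_of_real[symmetric] scaleC_scaleC mult.commute)
  show "norm (c *\<^sub>C x) \<le> norm x * cmod c" for x :: 'a by (simp add: norm_scaleC)
qed (rule scaleC_add_right)

lemma bounded_linear_image_closure:
  fixes A :: "'a::real_normed_vector \<Rightarrow> 'b::real_normed_vector"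
  assumes "bounded_linear A" "\<And>x. x \<in> S \<Longrightarrow> A x \<in> T" "x \<in> closure S"
  shows "A x \<in> closure T"
proof -
  have "A ` closure S \<subseteq> closure T"
  proof (rule image_closure_subset)
    show "continuous_on (closure S) A"
      by (rule linear_continuous_on) (rule assms)
    show "A ` S \<subseteq> closure T"
      using assms(2) closure_subset by fastforce
  qed simp
  then show ?thesis using assms(3) by auto
qed

lemma csubspace_closure:
  assumes "csubspace (S :: 'a::complex_inner set)"
  shows "csubspace (closure S)"
  unfolding complex_vector.subspace_def
proof (intro conjI ballI allI)
  show "0 \<in> closure S"
    using assms closure_subset complex_vector.subspace_0 by blast
  show "c *\<^sub>C x \<in> closure S" if "x \<in> closure S" for c x
    using bounded_linear_image_closure[OF bounded_linear_scaleC _ that, of c S]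
      complex_vector.subspace_scale[OF assms] by blast
  fix x y assume "x \<in> closure S" "y \<in> closure S"
  then obtain u v where "\<forall>n. u n \<in> S" "u \<longlonglongrightarrow> x" "\<forall>n. v n \<in> S" "v \<longlonglongrightarrow> y"
    unfolding closure_sequential by metis
  then show "x + y \<in> closure S"
    unfolding closure_sequential using complex_vector.subspace_add[OF assms]
    by (intro exI[of _ "\<lambda>n. u n + v n"]) (auto intro: tendsto_add)
qed

lemma csubspace_imp_subspace:
  "csubspace (S :: 'a::complex_inner set) \<Longrightarrow> subspace S"
  unfolding complex_vector.subspace_def subspace_def
  by (metis scaleC_of_real)

lemma complete_system_iff:
  assumes "S \<subseteq> V" "csubspace V" "closed V"
  shows "complete_system S V \<longleftrightarrow> V \<subseteq> closure (cspan S)"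
  unfolding complete_system_def
  using closure_minimal[OF complex_vector.span_minimal[OF assms(1,2)] assms(3)] by auto

section \<open>Orthogonal projection onto a closed subspace\<close>

lemma ex_closest_point_subspace:
  fixes V :: "'a::{real_inner, complete_space} set"
  assumes V: "subspace V" "closed V"
  obtains v where "v \<in> V" "\<And>w. w \<in> V \<Longrightarrow> norm (x - v) \<le> norm (x - w)"
proof -
  define d where "d = infdist x V"
  have ne: "V \<noteq> {}" using V subspace_0 by blast
  have d_le: "d \<le> norm (x - w)" if "w \<in> V" for w
    using infdist_le[OF that, of x] by (simp add: d_def dist_norm)
  have d0: "d \<ge> 0" by (simp add: d_def infdist_nonneg)
  have "\<exists>v\<in>V. norm (x - v) < d + 1 / Suc n" for n
  proof -
    have "infdist x V < d + 1 / Suc n" by (simp add: d_def)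
    then show ?thesis
      unfolding infdist_notempty[OF ne] using ne
      by (subst (asm) cINF_less_iff) (auto simp: dist_norm intro!: bdd_belowI2[where m=0])
  qed
  then obtain v where v: "\<And>n. v n \<in> V" "\<And>n. norm (x - v n) < d + 1 / Suc n" by metis
  \<comment> \<open>Parallelogram law: the midpoint of \<open>v m\<close> and \<open>v n\<close>
    stays in \<open>V\<close>, so \<open>?a + ?b\<close> has norm at least \<open>2 * d\<close>.
    This is what makes the minimizing sequence Cauchy.\<close>
  have par: "(norm (v m - v n))\<^sup>2 \<le> 2 * (norm (x - v m))\<^sup>2 + 2 * (norm (x - v n))\<^sup>2 - 4 * d\<^sup>2" for m n
  proof -
    let ?a = "x - v m" and ?b = "x - v n"
    have mid: "(1/2) *\<^sub>R (v m + v n) \<in> V"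
      using V(1) v(1) by (meson subspace_add subspace_scale)
    have "?a + ?b = 2 *\<^sub>R (x - (1/2) *\<^sub>R (v m + v n))"
      by (simp add: algebra_simps scaleR_2)
    then have "norm (?a + ?b) \<ge> 2 * d"
      using d_le[OF mid] by simp
    then have "(norm (?a + ?b))\<^sup>2 \<ge> 4 * d\<^sup>2"
      using power_mono[of "2 * d" "norm (?a + ?b)" 2] d0 by (simp add: power_mult_distrib)
    moreover have "(norm (?a + ?b))\<^sup>2 + (norm (?a - ?b))\<^sup>2 = 2 * (norm ?a)\<^sup>2 + 2 * (norm ?b)\<^sup>2"
      unfolding power2_norm_eq_inner by (simp add: inner_simps inner_commute)
    moreover have "norm (?a - ?b) = norm (v m - v n)" by (simp add: norm_minus_commute)
    ultimately show ?thesis by simp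
  qed
  have lim: "(\<lambda>n. norm (x - v n)) \<longlonglongrightarrow> d"
  proof (rule tendsto_sandwich[where f = "\<lambda>_. d" and h = "\<lambda>n. d + 1 / Suc n"])
    show "(\<lambda>n. d + 1 / Suc n) \<longlonglongrightarrow> d"
      using tendsto_add[OF tendsto_const[of d] LIMSEQ_inverse_real_of_nat] by (simp add: inverse_eq_divide)
  qed (use v d_le in \<open>auto intro!: always_eventually simp: less_imp_le\<close>)
  have "Cauchy v"
    unfolding Cauchy_iff
  proof (intro allI impI)
    fix e :: real assume e: "e > 0"
    have "(\<lambda>n. (norm (x - v n))\<^sup>2) \<longlonglongrightarrow> d\<^sup>2" by (intro tendsto_intros lim)
    then have "\<forall>\<^sub>F n in sequentially. (norm (x - v n))\<^sup>2 < d\<^sup>2 + e\<^sup>2/4"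
      by (rule order_tendstoD) (use e in simp)
    then obtain N where N: "\<And>n. n \<ge> N \<Longrightarrow> (norm (x - v n))\<^sup>2 < d\<^sup>2 + e\<^sup>2/4"
      unfolding eventually_sequentially by blast
    have "norm (v m - v n) < e" if "m \<ge> N" "n \<ge> N" for m n
    proof -
      have "(norm (v m - v n))\<^sup>2 < e\<^sup>2" using par[of m n] N[OF that(1)] N[OF that(2)] by argo
      then show ?thesis using e power_less_imp_less_base by fastforce
    qed
    then show "\<exists>M. \<forall>m\<ge>M. \<forall>n\<ge>M. norm (v m - v n) < e" by blast
  qed
  then obtain u where u: "v \<longlonglongrightarrow> u" using Cauchy_convergent convergent_def by blast
  have "u \<in> V" using V(2) u v(1) closed_sequentially by blast
  moreover have "norm (x - u) = d"
    by (rule LIMSEQ_unique[OF _ lim]) (intro tendsto_intros u)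
  ultimately show thesis using d_le that by metis
qed

lemma ex_orthogonal_vector:
  fixes V :: "'a::chilbert_space set"
  assumes V: "csubspace V" "closed V" and x: "x \<notin> V"
  obtains f where "f \<noteq> 0" "\<And>w. w \<in> V \<Longrightarrow> cinner f w = 0"
proof -
  note sub = csubspace_imp_subspace[OF V(1)]
  obtain v where v: "v \<in> V" "\<And>w. w \<in> V \<Longrightarrow> norm (x - v) \<le> norm (x - w)"
    using ex_closest_point_subspace[OF sub V(2)] by metis
  define f where "f = x - v"
  have re: "inner f w = 0" if w: "w \<in> V" for w
  proof (rule ccontr)
    assume nz: "inner f w \<noteq> 0"
    then have ww: "inner w w > 0" by auto
    \<comment> \<open>Moving \<open>v\<close> by the projection of \<open>f\<close> onto
      \<open>w\<close> would bring it strictly closer to \<open>x\<close> unless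
      \<open>inner f w\<close> is zero.\<close>
    define t where "t = inner f w / inner w w"
    have "v + t *\<^sub>R w \<in> V" using sub v(1) w by (simp add: subspace_add subspace_scale)
    then have "norm f \<le> norm (x - (v + t *\<^sub>R w))" unfolding f_def by (rule v(2))
    then have "norm f \<le> norm (f - t *\<^sub>R w)" by (simp add: f_def algebra_simps)
    then have "(norm f)\<^sup>2 \<le> (norm (f - t *\<^sub>R w))\<^sup>2" by (rule power_mono) simp
    then have "2 * t * inner f w \<le> t * t * inner w w"
      unfolding power2_norm_eq_inner by (simp add: inner_simps inner_commute)
    also have "t * t * inner w w = t * inner f w" using ww by (simp add: t_def)
    finally have "t * inner f w \<le> 0" by simp
    moreover have "t * inner f w > 0"
      using nz ww by (auto simp: t_def zero_less_mult_iff zero_less_divide_iff divide_less_0_iff)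
    ultimately show False by simp
  qed
  show thesis
  proof (rule that[of f])
    show "f \<noteq> 0" using x v(1) by (auto simp: f_def)
    fix w assume w: "w \<in> V"
    \<comment> \<open>So far orthogonality is only real. As \<open>V\<close> is a complex subspace,
      testing against \<open>\<i> *\<^sub>C w\<close> yields the imaginary part of
      \<open>cinner f w\<close>.\<close>
    have "Re (cinner f (\<i> *\<^sub>C w)) = 0"
      using re[OF complex_vector.subspace_scale[OF V(1) w]] by (simp add: Re_cinner)
    then show "cinner f w = 0"
      using re[OF w] by (intro complex_eqI) (simp_all add: cinner_scaleC_right Re_cinner)
  qed
qed

lemma complete_systemI_orthogonal:
  fixes S :: "'a::chilbert_space set"
  assumes "\<And>f. (\<And>s. s \<in> S \<Longrightarrow> cinner s f = 0) \<Longrightarrow> f = 0"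
  shows "complete_system S UNIV"
proof (rule ccontr)
  assume "\<not> complete_system S UNIV"
  then obtain x where "x \<notin> closure (cspan S)" unfolding complete_system_def by auto
  moreover have "csubspace (closure (cspan S))"
    by (intro csubspace_closure complex_vector.subspace_span)
  ultimately obtain f where f: "f \<noteq> 0" "\<And>w. w \<in> closure (cspan S) \<Longrightarrow> cinner f w = 0"
    using ex_orthogonal_vector[OF _ closed_closure] by metis
  have "cinner s f = 0" if "s \<in> S" for s
    using f(2)[of s] that closure_subset[of "cspan S"] complex_vector.span_base[OF that]
    by (auto simp: cinner_eq_zero_sym)
  with assms f(1) show False by blast
qed

lemma cinner_eq_0_closure_cspan:
  assumes "\<And>s. s \<in> S \<Longrightarrow> cinner s (f::'a::complex_inner) = 0" "x \<in> closure (cspan S)"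
  shows "cinner x f = 0"
proof -
  have "cinner y f = 0" if "y \<in> cspan S" for y
    using that
    by (induction rule: complex_vector.span_induct_alt)
      (auto simp: cinner_add_left cinner_scaleC_left assms(1))
  then have "cinner x f \<in> closure {0}"
    by (intro bounded_linear_image_closure[OF bounded_linear_cinner_left _ assms(2)]) auto
  then show ?thesis by simp
qed

section \<open>Analytic continuation and moments of integrals\<close>

text \<open>The bound on \<open>f\<close> is asked only where \<open>h\<close> does not vanish:
  polynomials are unbounded on the plane but will be multiplied by functions living in a
  disc.\<close>

lemma integrable_mult_bounded:
  fixes f h :: "'a \<Rightarrow> complex"
  assumes "integrable M h" "f \<in> borel_measurable M"
    and "\<And>x. x \<in> space M \<Longrightarrow> h x \<noteq> 0 \<Longrightarrow> cmod (f x) \<le> C"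
  shows "integrable M (\<lambda>x. f x * h x)"
proof (rule Bochner_Integration.integrable_bound)
  show "integrable M (\<lambda>x. C * norm (h x))" using assms(1) by simp
  show "(\<lambda>x. f x * h x) \<in> borel_measurable M" using assms(1,2) by simp
  show "AE x in M. norm (f x * h x) \<le> norm (C * norm (h x))"
  proof (rule AE_I2)
    fix x assume x: "x \<in> space M"
    show "norm (f x * h x) \<le> norm (C * norm (h x))"
    proof (cases "h x = 0")
      case False
      then have "cmod (f x) \<le> \<bar>C\<bar>" using assms(3)[OF x] by fastforce
      then show ?thesis by (simp add: norm_mult abs_mult mult_right_mono)
    qed simp
  qed
qed

section \<open>Identity theorem for power series and exponential integrals\<close>

lemma powser_eq_0_extend:
  fixes a :: "nat \<Rightarrow> real"
  assumes sums: "\<And>x. \<bar>x\<bar> < r \<Longrightarrow> (\<lambda>n. a n * x ^ n) sums f x"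
    and zero: "\<And>x. \<bar>x\<bar> < e \<Longrightarrow> f x = 0" and e: "0 < e" and x: "\<bar>x\<bar> < r"
  shows "f x = 0"
proof -
  have f0: "f 0 = 0" using zero[of 0] e by simp
  have r: "r > 0" using x by linarith
  have "a n = 0" for n
  proof (cases "n = 0")
    case True
    have "(\<lambda>n. a n * 0 ^ n) sums a 0" by (rule powser_sums_zero)
    with sums[of 0] r f0 True show ?thesis by (simp add: sums_unique2)
  next
    case False
    show ?thesis
    proof (rule ccontr)
      assume nz: "a n \<noteq> 0"
      \<comment> \<open>A nonzero coefficient would make 0 an isolated zero of \<open>f\<close>,
        against vanishing within radius \<open>e\<close>. The constant term is settled apart because
        isolation presupposes \<open>f 0 = 0\<close> and a positive index.\<close>
      obtain s where s: "0 < s" "\<And>z. z \<in> cball 0 s - {0} \<Longrightarrow> f z \<noteq> 0"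
        using powser_0_nonzero[of r 0 a f n] sums r f0 nz False by auto
      have "f (min s (e/2)) \<noteq> 0" using s e by auto
      moreover have "f (min s (e/2)) = 0" using s e by (intro zero) auto
      ultimately show False by simp
    qed
  qed
  then show ?thesis using sums[OF x] sums_unique2[OF sums_zero] by simp
qed

context
  fixes M :: "'a measure" and H w :: "'a \<Rightarrow> complex" and c d :: real
  assumes H: "integrable M H" and w [measurable]: "w \<in> borel_measurable M"
    and Re_w: "\<And>x. x \<in> space M \<Longrightarrow> Re (w x) \<le> c"
    and Im_w: "\<And>x. x \<in> space M \<Longrightarrow> \<bar>Im (w x)\<bar> \<le> d"
    and c: "0 \<le> c"
begin

text \<open>Expanding \<open>exp (s w)\<close> is legitimate although \<open>w\<close> is unbounded: where \<open>Re w\<close> tends to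
  \<open>-\<infinity>\<close>, the factor \<open>exp (t w)\<close> compensates \<open>exp (\<bar>s\<bar> \<bar>w\<bar>)\<close> as long as \<open>\<bar>s\<bar> \<le> t\<close>.\<close>

lemma exp_integral_sums:
  assumes s: "\<bar>s\<bar> \<le> t"
  shows "(\<lambda>k. (LINT x|M. w x ^ k * exp (complex_of_real t * w x) * H x) / fact k * complex_of_real s ^ k)
    sums (LINT x|M. exp (complex_of_real (t + s) * w x) * H x)"
proof -
  define f where "f k x = (complex_of_real s * w x) ^ k / fact k * (exp (complex_of_real t * w x) * H x)" for k x
  \<comment> \<open>The exponent bounds \<open>\<bar>s\<bar> * cmod (w x) + t * Re (w x)\<close>. As
    \<open>\<bar>s\<bar> \<le> t\<close>, this is at most
    \<open>t * (\<bar>Re (w x)\<bar> + Re (w x)) + t * d\<close>, and the bracket is twice the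
    positive part of \<open>Re (w x)\<close>, so at most \<open>2 * c\<close>.\<close>
  define C where "C = exp (2 * t * c + t * d)"
  have t0: "t \<ge> 0" using s by linarith
  have H_meas [measurable]: "H \<in> borel_measurable M" using H by simp
  have nf: "norm (f k x) = (\<bar>s\<bar> * cmod (w x)) ^ k /\<^sub>R fact k * (cmod (exp (complex_of_real t * w x)) * cmod (H x))" for k x
    by (simp add: f_def norm_mult norm_divide norm_power norm_inverse divide_inverse mult.commute)
  have sums_nf: "(\<lambda>k. norm (f k x)) sums (exp (\<bar>s\<bar> * cmod (w x)) * (cmod (exp (complex_of_real t * w x)) * cmod (H x)))" for x
    unfolding nf by (intro sums_mult2 exp_converges)
  have sums_f: "(\<lambda>k. f k x) sums (exp (complex_of_real (t + s) * w x) * H x)" for x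
  proof -
    have "(\<lambda>k. (complex_of_real s * w x) ^ k /\<^sub>R fact k * (exp (complex_of_real t * w x) * H x))
      sums (exp (complex_of_real s * w x) * (exp (complex_of_real t * w x) * H x))"
      by (intro sums_mult2 exp_converges)
    then show ?thesis
      by (simp add: f_def scaleR_conv_of_real divide_inverse exp_add ring_distribs mult_ac)
  qed
  have le: "exp (\<bar>s\<bar> * cmod (w x)) * (cmod (exp (complex_of_real t * w x)) * cmod (H x)) \<le> C * cmod (H x)"
    if x: "x \<in> space M" for x
  proof -
    have "\<bar>s\<bar> * cmod (w x) \<le> t * (\<bar>Re (w x)\<bar> + d)"
      using s cmod_le[of "w x"] Im_w[OF x] by (intro mult_mono) auto
    moreover have "t * (\<bar>Re (w x)\<bar> + Re (w x)) \<le> t * (2 * c)"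
      using Re_w[OF x] c t0 by (intro mult_left_mono) auto
    ultimately have "\<bar>s\<bar> * cmod (w x) + t * Re (w x) \<le> 2 * t * c + t * d"
      by (simp add: algebra_simps)
    then have "exp (\<bar>s\<bar> * cmod (w x)) * cmod (exp (complex_of_real t * w x)) \<le> C"
      by (simp add: C_def exp_add[symmetric])
    then show ?thesis by (metis mult.assoc mult_right_mono norm_ge_zero)
  qed
  \<comment> \<open>One bound for all finite partial sums serves twice: singletons give
    integrability of each \<open>f k\<close>, initial segments give summability of the integrals and
    hence termwise integration.\<close>
  have part: "(\<Sum>k\<in>K. norm (f k x)) \<le> C * cmod (H x)" if "x \<in> space M" "finite K" for x K
  proof -
    have "(\<Sum>k\<in>K. norm (f k x)) \<le> exp (\<bar>s\<bar> * cmod (w x)) * (cmod (exp (complex_of_real t * w x)) * cmod (H x))"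
      using sums_nf[of x] sum_le_suminf[OF _ that(2), of "\<lambda>k. norm (f k x)"]
      by (auto simp: sums_iff)
    with le[OF that(1)] show ?thesis by linarith
  qed
  have int: "integrable M (f k)" for k
  proof (rule Bochner_Integration.integrable_bound)
    show "integrable M (\<lambda>x. C * cmod (H x))" using H by simp
    show "f k \<in> borel_measurable M" unfolding f_def by measurable
    show "AE x in M. norm (f k x) \<le> norm (C * cmod (H x))"
      using part[of _ "{k}"] by (intro AE_I2) (simp add: C_def)
  qed
  have summ: "summable (\<lambda>k. LINT x|M. norm (f k x))"
  proof (rule summableI_nonneg_bounded[where x = "LINT x|M. C * cmod (H x)"])
    fix n
    have "(\<Sum>k<n. LINT x|M. norm (f k x)) = (LINT x|M. (\<Sum>k<n. norm (f k x)))"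
      using int by (intro Bochner_Integration.integral_sum[symmetric]) auto
    also have "\<dots> \<le> (LINT x|M. C * cmod (H x))"
      using int H part by (intro integral_mono) auto
    finally show "(\<Sum>k<n. LINT x|M. norm (f k x)) \<le> (LINT x|M. C * cmod (H x))" .
  qed (simp add: integral_nonneg_AE)
  have "(\<lambda>k. LINT x|M. f k x) sums (LINT x|M. (\<Sum>k. f k x))"
    using sums_nf by (intro sums_integral int summ) (auto simp: sums_iff)
  also have "(\<lambda>x. \<Sum>k. f k x) = (\<lambda>x. exp (complex_of_real (t + s) * w x) * H x)"
    using sums_f by (auto simp: sums_iff)
  also have "(\<lambda>k. LINT x|M. f k x) =
    (\<lambda>k. (LINT x|M. w x ^ k * exp (complex_of_real t * w x) * H x) / fact k * complex_of_real s ^ k)"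
  proof
    fix k
    have "(LINT x|M. f k x) = (LINT x|M. (complex_of_real s ^ k / fact k) * (w x ^ k * exp (complex_of_real t * w x) * H x))"
      by (simp add: f_def power_mult_distrib mult_ac)
    also have "\<dots> = (complex_of_real s ^ k / fact k) * (LINT x|M. w x ^ k * exp (complex_of_real t * w x) * H x)"
      by (rule integral_mult_right_zero)
    finally show "(LINT x|M. f k x) = (LINT x|M. w x ^ k * exp (complex_of_real t * w x) * H x) / fact k * complex_of_real s ^ k"
      by simp
  qed
  finally show ?thesis .
qed

text \<open>The expansion about a point reaches down to 0 and up to twice that point. A centre
  inside the known interval but beyond its middle therefore gains length by a fixed factor, and
  iteration covers every positive \<open>t\<close>.\<close>

lemma exp_integral_eq_0:
  assumes L: "0 < L"
    and zero: "\<And>t. 0 < t \<Longrightarrow> t < L \<Longrightarrow> (LINT x|M. exp (complex_of_real t * w x) * H x) = 0"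
    and t: "0 < t"
  shows "(LINT x|M. exp (complex_of_real t * w x) * H x) = 0"
proof -
  define F where "F t = (LINT x|M. exp (complex_of_real t * w x) * H x)" for t
  have step: "F t = 0" if l: "0 < l" and Fl: "\<And>t. 0 < t \<Longrightarrow> t < l \<Longrightarrow> F t = 0" and t: "0 < t" "t < 3/2 * l" for l t
  proof -
    \<comment> \<open>Centred at three quarters of \<open>l\<close>, the series covers
      \<open>0 < t < 3/2 * l\<close>, while the window \<open>\<bar>s\<bar> < l/4\<close> stays
      between \<open>l/2\<close> and \<open>l\<close>, where \<open>F\<close> is known to
      vanish.\<close>
    define t0 where "t0 = 3/4 * l"
    define a where "a k = (LINT x|M. w x ^ k * exp (complex_of_real t0 * w x) * H x) / fact k" for k
    have sums: "(\<lambda>k. a k * complex_of_real s ^ k) sums F (t0 + s)" if "\<bar>s\<bar> < t0" for s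
      using exp_integral_sums[of s t0] that by (simp add: a_def F_def)
    have re: "(\<lambda>k. Re (a k) * s ^ k) sums Re (F (t0 + s))" if "\<bar>s\<bar> < t0" for s
      using bounded_linear.sums[OF bounded_linear_Re sums[OF that]] by (simp flip: of_real_power)
    have im: "(\<lambda>k. Im (a k) * s ^ k) sums Im (F (t0 + s))" if "\<bar>s\<bar> < t0" for s
      using bounded_linear.sums[OF bounded_linear_Im sums[OF that]] by (simp flip: of_real_power)
    have z: "F (t0 + s) = 0" if "\<bar>s\<bar> < l/4" for s
      using that by (intro Fl) (auto simp: t0_def)
    have st: "\<bar>t - t0\<bar> < t0" using t unfolding t0_def by linarith
    have "Re (F (t0 + (t - t0))) = 0"
      by (rule powser_eq_0_extend[where f="\<lambda>s. Re (F (t0 + s))" and e="l/4", OF re _ _ st]) (use z l in auto)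
    moreover have "Im (F (t0 + (t - t0))) = 0"
      by (rule powser_eq_0_extend[where f="\<lambda>s. Im (F (t0 + s))" and e="l/4", OF im _ _ st]) (use z l in auto)
    ultimately show ?thesis by (simp add: complex_eq_iff)
  qed
  have "\<forall>t. 0 < t \<and> t < (3/2) ^ n * L \<longrightarrow> F t = 0" for n
  proof (induction n)
    case (Suc n)
    then show ?case using step[of "(3/2) ^ n * L"] L by (simp add: mult.assoc)
  qed (use zero in \<open>simp add: F_def\<close>)
  moreover obtain n where "t / L < (3/2 :: real) ^ n" using real_arch_pow[of "3/2" "t/L"] by auto
  ultimately show ?thesis using t L by (auto simp: F_def field_simps)
qed

end

section \<open>Functions of bounded support with vanishing moments\<close>

lemma bounded_linear_complex_real:
  assumes "bounded_linear (f :: complex \<Rightarrow> real)"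
  shows "f z = Re z * f 1 + Im z * f \<i>"
proof -
  interpret bounded_linear f by fact
  have "z = Re z *\<^sub>R 1 + Im z *\<^sub>R \<i>" by (simp add: complex_eq_iff)
  then have "f z = f (Re z *\<^sub>R 1 + Im z *\<^sub>R \<i>)" by simp
  then show ?thesis by (simp add: add scaleR)
qed

text \<open>Polynomials in \<open>z\<close> and \<open>cnj z\<close> are the complex polynomials in
  the real coordinates, so all of them integrate to 0 against \<open>h\<close>. Uniform
  approximation on the disc of radius \<open>K\<close> extends this to continuous functions,
  dominated convergence to indicators of closed sets, and a Dynkin argument to Borel sets.\<close>

lemma AE_eq_0_if_moments_eq_0:
  fixes h :: "complex \<Rightarrow> complex"
  assumes sets_M [measurable_cong]: "sets M = sets borel" and int_h: "integrable M h"
    and supp_h: "\<And>z. h z \<noteq> 0 \<Longrightarrow> cmod z \<le> K"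
    and moments: "\<And>n m. (LINT z|M. z ^ n * cnj z ^ m * h z) = 0"
  shows "AE z in M. h z = 0"
proof -
  \<comment> \<open>Working with the class of all such functions lets the induction on polynomials
    absorb each factor into \<open>h\<close>; the product case then just applies the two induction
    hypotheses in turn.\<close>
  define \<N> where "\<N> = {h. integrable M h \<and> (\<forall>z. h z \<noteq> 0 \<longrightarrow> cmod z \<le> K) \<and>
    (\<forall>n m. (LINT z|M. z ^ n * cnj z ^ m * h z) = 0)}"
  have bnd: "\<exists>C. \<forall>z. cmod z \<le> K \<longrightarrow> norm (f z) \<le> C" if "continuous_on UNIV f" for f :: "complex \<Rightarrow> 'b::real_normed_vector"
  proof -
    have "bounded (f ` cball 0 K)"
      by (meson compact_cball compact_continuous_image compact_imp_bounded continuous_on_subset subset_UNIV that)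
    then obtain C where "\<forall>z\<in>cball 0 K. norm (f z) \<le> C" unfolding bounded_iff by auto
    then show ?thesis by (intro exI[of _ C]) auto
  qed
  have int_mult: "integrable M (\<lambda>z. f z * h z)" if h: "h \<in> \<N>" and f: "continuous_on UNIV f" for f h
  proof -
    obtain C where C: "\<And>z. cmod z \<le> K \<Longrightarrow> norm (f z) \<le> C" using bnd[OF f] by blast
    show ?thesis
    proof (rule integrable_mult_bounded)
      show "f \<in> borel_measurable M" using f by (simp cong: measurable_cong_sets add: sets_M borel_measurable_continuous_onI)
    qed (use h C in \<open>auto simp: \<N>_def\<close>)
  qed
  have poly: "\<forall>h\<in>\<N>. (\<lambda>z. complex_of_real (p z) * h z) \<in> \<N>" if "real_polynomial_function p" for p :: "complex \<Rightarrow> real"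
    using that
  proof (induction p rule: real_polynomial_function.induct)
    case (linear f)
    \<comment> \<open>Substitute \<open>Re z = (z + cnj z) / 2\<close> and
      \<open>Im z = (z - cnj z) / (2 * \<i>)\<close> in the real-linear functional \<open>f\<close>:
      multiplying by it only raises \<open>n\<close> or \<open>m\<close> by one.\<close>
    define \<alpha> \<beta> where "\<alpha> = Complex (f 1 / 2) (- f \<i> / 2)" and "\<beta> = Complex (f 1 / 2) (f \<i> / 2)"
    have f: "complex_of_real (f z) = \<alpha> * z + \<beta> * cnj z" for z
      using bounded_linear_complex_real[OF linear, of z]
      by (simp add: complex_eq_iff \<alpha>_def \<beta>_def field_simps)
    have cf: "continuous_on UNIV (\<lambda>z. complex_of_real (f z))"
      by (intro continuous_on_of_real linear_continuous_on linear)
    show ?case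
    proof
      fix h assume h: "h \<in> \<N>"
      have "(LINT z|M. z ^ n * cnj z ^ m * (complex_of_real (f z) * h z)) = 0" for n m
      proof -
        have "(LINT z|M. z ^ n * cnj z ^ m * (complex_of_real (f z) * h z)) =
          (LINT z|M. \<alpha> * (z ^ Suc n * cnj z ^ m * h z) + \<beta> * (z ^ n * cnj z ^ Suc m * h z))"
          by (rule Bochner_Integration.integral_cong) (auto simp: f algebra_simps)
        also have "\<dots> = \<alpha> * (LINT z|M. z ^ Suc n * cnj z ^ m * h z) + \<beta> * (LINT z|M. z ^ n * cnj z ^ Suc m * h z)"
          by (subst Bochner_Integration.integral_add)
            (intro integrable_mult_right int_mult h continuous_intros | simp)+
        also have "\<dots> = 0"
        proof -
          have "(LINT z|M. z ^ Suc n * cnj z ^ m * h z) = 0" "(LINT z|M. z ^ n * cnj z ^ Suc m * h z) = 0"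
            using h unfolding \<N>_def by blast+
          then show ?thesis by (simp only: mult_zero_right add_0)
        qed
        finally show ?thesis .
      qed
      moreover have "integrable M (\<lambda>z. complex_of_real (f z) * h z)" by (rule int_mult[OF h cf])
      ultimately show "(\<lambda>z. complex_of_real (f z) * h z) \<in> \<N>"
        using h by (auto simp: \<N>_def)
    qed
  next
    case (const c)
    have "(\<lambda>z. complex_of_real c * h z) \<in> \<N>" if "h \<in> \<N>" for h
    proof -
      have "(LINT z|M. z ^ n * cnj z ^ m * (complex_of_real c * h z)) = 0" for n m
      proof -
        have "(LINT z|M. z ^ n * cnj z ^ m * (complex_of_real c * h z)) = complex_of_real c * (LINT z|M. z ^ n * cnj z ^ m * h z)"
          by (subst integral_mult_right_zero[symmetric]) (simp add: mult_ac)
        then show ?thesis using that by (simp add: \<N>_def)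
      qed
      then show ?thesis using that by (auto simp: \<N>_def)
    qed
    then show ?case by blast
  next
    case (add f g)
    have "(\<lambda>z. complex_of_real (f z + g z) * h z) \<in> \<N>" if h: "h \<in> \<N>" for h
    proof -
      let ?f = "\<lambda>z. complex_of_real (f z) * h z" and ?g = "\<lambda>z. complex_of_real (g z) * h z"
      have fg: "?f \<in> \<N>" "?g \<in> \<N>" using add h by auto
      have "(LINT z|M. z ^ n * cnj z ^ m * (complex_of_real (f z + g z) * h z)) = 0" for n m
      proof -
        have "(LINT z|M. z ^ n * cnj z ^ m * (complex_of_real (f z + g z) * h z)) =
          (LINT z|M. z ^ n * cnj z ^ m * ?f z + z ^ n * cnj z ^ m * ?g z)"
          by (rule Bochner_Integration.integral_cong) (auto simp: algebra_simps)
        also have "\<dots> = (LINT z|M. z ^ n * cnj z ^ m * ?f z) + (LINT z|M. z ^ n * cnj z ^ m * ?g z)"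
          by (intro Bochner_Integration.integral_add int_mult fg continuous_intros)
        also have "\<dots> = 0" using fg by (simp add: \<N>_def)
        finally show ?thesis .
      qed
      moreover have "integrable M (\<lambda>z. ?f z + ?g z)" using fg by (intro Bochner_Integration.integrable_add) (auto simp: \<N>_def)
      then have "integrable M (\<lambda>z. complex_of_real (f z + g z) * h z)" by (simp add: ring_distribs)
      ultimately show ?thesis using h by (auto simp: \<N>_def simp del: of_real_add)
    qed
    then show ?case by blast
  next
    case (mult f g)
    then show ?case by (auto simp: mult.assoc)
  qed
  have hN: "h \<in> \<N>" using int_h supp_h moments by (auto simp: \<N>_def)
  have cont: "(LINT z|M. complex_of_real (\<phi> z) * h z) = 0" if \<phi>: "continuous_on UNIV \<phi>" for \<phi> :: "complex \<Rightarrow> real"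
  proof -
    let ?I = "LINT z|M. complex_of_real (\<phi> z) * h z" and ?J = "LINT z|M. norm (h z)"
    have int\<phi>: "integrable M (\<lambda>z. complex_of_real (\<phi> z) * h z)" by (intro int_mult hN continuous_on_of_real \<phi>)
    have J: "?J \<ge> 0" by simp
    have le: "norm ?I \<le> e * ?J" if e: "e > 0" for e
    proof -
      obtain p where p: "real_polynomial_function p" "\<And>z. z \<in> cball 0 K \<Longrightarrow> \<bar>\<phi> z - p z\<bar> < e"
        using Stone_Weierstrass_real_polynomial_function[of "cball 0 K" \<phi> e] \<phi> e
        by (metis compact_cball continuous_on_subset subset_UNIV)
      have pN: "(\<lambda>z. complex_of_real (p z) * h z) \<in> \<N>" using poly[OF p(1)] hN by blast
      then have intp: "integrable M (\<lambda>z. complex_of_real (p z) * h z)" by (simp add: \<N>_def)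
      have "(LINT z|M. z ^ 0 * cnj z ^ 0 * (complex_of_real (p z) * h z)) = 0" using pN unfolding \<N>_def by blast
      then have p0: "(LINT z|M. complex_of_real (p z) * h z) = 0" by simp
      have "?I = (LINT z|M. complex_of_real (\<phi> z) * h z - complex_of_real (p z) * h z)"
        using Bochner_Integration.integral_diff[OF int\<phi> intp] p0 by simp
      also have "norm \<dots> \<le> (LINT z|M. norm (complex_of_real (\<phi> z) * h z - complex_of_real (p z) * h z))"
        by (rule integral_norm_bound)
      also have "\<dots> \<le> (LINT z|M. e * norm (h z))"
      proof (rule integral_mono)
        show "norm (complex_of_real (\<phi> z) * h z - complex_of_real (p z) * h z) \<le> e * norm (h z)" for z
        proof (cases "h z = 0")
          case False
          then have "\<bar>\<phi> z - p z\<bar> \<le> e" using p(2)[of z] supp_h[of z] by force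
          then show ?thesis by (simp add: left_diff_distrib[symmetric] of_real_diff[symmetric] norm_mult mult_right_mono del: of_real_diff)
        qed simp
      qed (use int\<phi> intp int_h in auto)
      finally show ?thesis by simp
    qed
    have "norm ?I \<le> 0 + e" if e: "e > 0" for e
    proof -
      \<comment> \<open>Dividing by \<open>?J + 1\<close> instead of \<open>?J\<close> covers the
        case \<open>?J = 0\<close>.\<close>
      have J1: "?J + 1 > 0" using J by linarith
      have "e / (?J + 1) * ?J \<le> e / (?J + 1) * (?J + 1)" using e J1 by (intro mult_left_mono) auto
      also have "\<dots> = e" using J1 by simp
      finally show ?thesis using le[of "e / (?J + 1)"] e J1 by simp
    qed
    then have "norm ?I \<le> 0" by (rule field_le_epsilon)
    then show ?thesis by simp
  qed
  have closed: "(LINT z|M. indicator B z *\<^sub>R h z) = 0" if B: "closed B" "B \<noteq> {}" for B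
  proof -
    \<comment> \<open>Continuous tents with values in \<open>[0, 1]\<close>, equal to 1 on
      \<open>B\<close> and eventually 0 at each point outside the closed set. \<open>B\<close> is
      nonempty here because \<open>infdist\<close> to the empty set is 0 by convention.\<close>
    define \<phi> where "\<phi> n z = max 0 (1 - real n * infdist z B)" for n z
    have lim: "(\<lambda>n. LINT z|M. complex_of_real (\<phi> n z) * h z) \<longlonglongrightarrow> (LINT z|M. indicator B z *\<^sub>R h z)"
    proof (rule integral_dominated_convergence[where w = "\<lambda>z. norm (h z)"])
      have [measurable]: "h \<in> borel_measurable M" using int_h by simp
      have [measurable]: "B \<in> sets M" using B by (simp add: sets_M)
      show "(\<lambda>z. indicator B z *\<^sub>R h z) \<in> borel_measurable M" by measurable
      have c: "continuous_on UNIV (\<lambda>z. complex_of_real (\<phi> n z))" for n unfolding \<phi>_def by (intro continuous_intros)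
      show "(\<lambda>z. complex_of_real (\<phi> n z) * h z) \<in> borel_measurable M" for n
        using int_mult[OF hN c] by simp
      show "AE z in M. norm (complex_of_real (\<phi> n z) * h z) \<le> norm (h z)" for n
        by (intro AE_I2) (auto simp: \<phi>_def norm_mult infdist_nonneg mult_left_le_one_le)
      show "AE z in M. (\<lambda>n. complex_of_real (\<phi> n z) * h z) \<longlonglongrightarrow> indicator B z *\<^sub>R h z"
      proof (rule AE_I2)
        fix z
        show "(\<lambda>n. complex_of_real (\<phi> n z) * h z) \<longlonglongrightarrow> indicator B z *\<^sub>R h z"
        proof (cases "z \<in> B")
          case True
          then show ?thesis by (simp add: \<phi>_def)
        next
          case False
          then have pos: "infdist z B > 0" using B infdist_pos_not_in_closed by blast
          obtain n0 :: nat where "real n0 * infdist z B > 1" using reals_Archimedean3[OF pos] by blast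
          moreover have "real n0 * infdist z B \<le> real n * infdist z B" if "n \<ge> n0" for n
            using that pos by (intro mult_right_mono) auto
          ultimately have "\<phi> n z = 0" if "n \<ge> n0" for n
            using that unfolding \<phi>_def by fastforce
          then have "\<forall>\<^sub>F n in sequentially. complex_of_real (\<phi> n z) * h z = 0"
            unfolding eventually_sequentially by (intro exI[of _ n0]) auto
          then show ?thesis using False by (simp add: tendsto_eventually)
        qed
      qed
    qed (use int_h in simp)
    have "(LINT z|M. complex_of_real (\<phi> n z) * h z) = 0" for n
      by (rule cont) (unfold \<phi>_def, intro continuous_intros)
    then show ?thesis using lim by (simp add: LIMSEQ_const_iff)
  qed
  have borel: "(LINT z|M. indicator B z *\<^sub>R h z) = 0" if "B \<in> sets borel" for B
  proof -
    have sets: "sigma_sets UNIV (Collect closed) = sets M"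
      unfolding sets_M borel_eq_closed by simp
    have "Int_stable (Collect closed :: complex set set)" by (auto simp: Int_stable_def)
    moreover have "(Collect closed :: complex set set) \<subseteq> Pow UNIV" by simp
    moreover have "B \<in> sigma_sets UNIV (Collect closed)" using that sets sets_M by simp
    ultimately show ?thesis
    proof (induction rule: sigma_sets_induct_disjoint)
      case (basic A)
      then show ?case using closed[of A] by (cases "A = {}") auto
    next
      case empty
      show ?case by simp
    next
      case (compl A)
      then have A: "A \<in> sets M" using sets by simp
      have "(LINT z|M. indicator (UNIV - A) z *\<^sub>R h z) = (LINT z|M. h z - indicator A z *\<^sub>R h z)"
        by (rule Bochner_Integration.integral_cong) (auto simp: indicator_def)
      also have "\<dots> = (LINT z|M. h z) - (LINT z|M. indicator A z *\<^sub>R h z)"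
        using int_h A by (intro Bochner_Integration.integral_diff integrable_mult_indicator) auto
      \<comment> \<open>The moment with both exponents 0 is the integral of \<open>h\<close> over
        the whole plane.\<close>
      also have "\<dots> = 0" using moments[of 0 0] compl by simp
      finally show ?case .
    next
      case (union A)
      have A: "A i \<in> sets M" for i using union(2) sets by auto
      have "set_lebesgue_integral M (\<Union>i. A i) h = (\<Sum>i. set_lebesgue_integral M (A i) h)"
        using union(1) A int_h
        by (intro lebesgue_integral_countable_add)
          (auto simp: disjoint_family_on_def set_integrable_def intro!: integrable_mult_indicator)
      then show ?case using union(3) by (simp add: set_lebesgue_integral_def)
    qed
  qed
  have real: "AE z in M. u z = 0" if u: "integrable M u" and "\<And>B. B \<in> sets borel \<Longrightarrow> (LINT z|M. indicator B z *\<^sub>R u z) = 0"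
    for u :: "complex \<Rightarrow> real"
  proof -
    have [measurable]: "u \<in> borel_measurable borel" using u sets_M by (simp cong: measurable_cong_sets)
    \<comment> \<open>On \<open>P\<close> and on its complement \<open>u\<close> has constant sign,
      so a zero integral over each forces \<open>u\<close> to vanish there.\<close>
    define P where "P = {z. 0 \<le> u z}"
    have P [measurable]: "P \<in> sets borel" unfolding P_def by measurable
    then have P': "P \<in> sets M" "- P \<in> sets M" by (auto simp: sets_M)
    have int: "integrable M (\<lambda>z. indicator B z *\<^sub>R u z)" if "B \<in> sets M" for B
      using that u by (rule integrable_mult_indicator)
    have "AE z in M. indicator P z *\<^sub>R u z = 0"
      using that(2)[OF P] by (subst (asm) integral_nonneg_eq_0_iff_AE[OF int[OF P'(1)]])
        (auto simp: P_def indicator_def)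
    moreover have "(LINT z|M. - (indicator (- P) z *\<^sub>R u z)) = 0"
      using that(2)[of "- P"] by simp
    then have "AE z in M. - (indicator (- P) z *\<^sub>R u z) = 0"
      by (subst (asm) integral_nonneg_eq_0_iff_AE[OF Bochner_Integration.integrable_minus[OF int[OF P'(2)]]])
        (auto simp: P_def indicator_def)
    ultimately show ?thesis by eventually_elim (auto simp: indicator_def split: if_splits)
  qed
  have "AE z in M. Re (h z) = 0"
  proof (rule real)
    fix B :: "complex set" assume B: "B \<in> sets borel"
    have "integrable M (\<lambda>z. indicator B z *\<^sub>R h z)" using B int_h by (intro integrable_mult_indicator) (auto simp: sets_M)
    from integral_Re[OF this] show "(LINT z|M. indicator B z *\<^sub>R Re (h z)) = 0"
      using borel[OF B] by simp
  qed (use int_h in auto)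
  moreover have "AE z in M. Im (h z) = 0"
  proof (rule real)
    fix B :: "complex set" assume B: "B \<in> sets borel"
    have "integrable M (\<lambda>z. indicator B z *\<^sub>R h z)" using B int_h by (intro integrable_mult_indicator) (auto simp: sets_M)
    from integral_Im[OF this] show "(LINT z|M. indicator B z *\<^sub>R Im (h z)) = 0"
      using borel[OF B] by simp
  qed (use int_h in auto)
  ultimately show ?thesis by eventually_elim (simp add: complex_eq_iff)
qed

section \<open>Square-summable sequences\<close>

lemma fibre_cinner_eq:
  assumes E: "disjoint_family_on E {1..}" and j: "1 \<le> j" "z \<in> E j"
  shows "fibre_cinner E F G z = cinner (F j z) (G j z)"
proof -
  have "fibre_cinner E F G z = (\<Sum>\<^sub>\<infinity>i\<in>{j}. indicator (E i) z * cinner (F i z) (G i z))"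
    unfolding fibre_cinner_def
  proof (rule infsum_cong_neutral)
    fix i assume "i \<in> {1..} - {j}"
    then have "z \<notin> E i" using E j unfolding disjoint_family_on_def by auto
    then show "indicator (E i) z * cinner (F i z) (G i z) = 0" by simp
  qed (use j in auto)
  then show ?thesis using j by simp
qed

lemma fibre_cinner_outside:
  assumes "\<And>j. 1 \<le> j \<Longrightarrow> z \<notin> E j"
  shows "fibre_cinner E F G z = 0"
  unfolding fibre_cinner_def by (rule infsum_0) (use assms in auto)

lemma fibre_cinner_scaleC:
  assumes "disjoint_family_on E {1..}"
  shows "fibre_cinner E (\<lambda>j z. m z *\<^sub>C F j z) (\<lambda>j z. n z *\<^sub>C G j z) z = m z * cnj (n z) * fibre_cinner E F G z"
proof (cases "\<exists>j\<ge>1. z \<in> E j")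
  case True
  then show ?thesis by (auto simp: fibre_cinner_eq[OF assms] cinner_scaleC_left cinner_scaleC_right)
next
  case False
  then show ?thesis by (subst (1 2) fibre_cinner_outside) auto
qed

lemma fibre_cinner_scaleC_left:
  assumes "disjoint_family_on E {1..}"
  shows "fibre_cinner E (\<lambda>j z. m z *\<^sub>C F j z) G z = m z * fibre_cinner E F G z"
  using fibre_cinner_scaleC[OF assms, of m F "\<lambda>_. 1" G] by simp

text \<open>The fibre product of a field with itself is a squared norm; writing it as its own
  modulus turns squared norms of vectors into integrals of nonnegative functions.\<close>

lemma fibre_cinner_self:
  assumes "disjoint_family_on E {1..}"
  shows "fibre_cinner E F F z = complex_of_real (cmod (fibre_cinner E F F z))"
proof (cases "\<exists>j\<ge>1. z \<in> E j")
  case True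
  then show ?thesis by (auto simp: fibre_cinner_eq[OF assms] cinner_self simp del: of_real_power)
next
  case False
  then show ?thesis by (subst (1 2) fibre_cinner_outside) auto
qed

lemma cinner_ell2_has_sum:
  assumes "x \<in> ell2_on I"
  shows "((\<lambda>k. coord x k * cnj (coord y k)) has_sum cinner x y) I"
proof -
  have summ: "summable (\<lambda>k. norm (coord x k * cnj (coord y k)))"
    by (intro square_summable_mult coord_summable)
  have "((\<lambda>k. coord x k * cnj (coord y k)) has_sum cinner x y) UNIV"
    unfolding cinner_ell2_def
    by (rule norm_summable_imp_has_sum[OF summ summable_sums[OF summable_norm_cancel[OF summ]]])
  then show ?thesis
    by (rule has_sum_cong_neutral[THEN iffD1, rotated -1]) (use assms in \<open>auto simp: ell2_on_def\<close>)
qed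

lift_definition unit_ell2 :: "nat \<Rightarrow> ell2" is "\<lambda>k i. if i = k then 1 else 0"
  subgoal for k by (rule summable_finite[of "{k}"]) auto
  done

lemma norm_unit_ell2 [simp]: "norm (unit_ell2 k) = 1"
proof -
  have "(norm (unit_ell2 k))\<^sup>2 = (\<Sum>i. (cmod (coord (unit_ell2 k) i))\<^sup>2)" by (rule norm_ell2_power2)
  also have "\<dots> = (\<Sum>i\<in>{k}. (cmod (coord (unit_ell2 k) i))\<^sup>2)"
    by (rule suminf_finite) (auto simp: unit_ell2.rep_eq)
  finally have "(norm (unit_ell2 k))\<^sup>2 = 1\<^sup>2" by (simp add: unit_ell2.rep_eq)
  then show ?thesis by (metis norm_ge_zero power2_eq_iff_nonneg zero_le_one)
qed

lemma csubspace_ell2_on: "csubspace (ell2_on I)"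
  unfolding complex_vector.subspace_def ell2_on_def
  by (auto simp: zero_ell2.rep_eq plus_ell2.rep_eq scaleC_ell2.rep_eq)

lemma closed_ell2_on: "closed (ell2_on I)"
proof -
  have lin: "bounded_linear (\<lambda>x. coord x k)" for k
    by (rule bounded_linear_intro[where K = 1])
      (auto simp: plus_ell2.rep_eq scaleR_ell2.rep_eq norm_coord_le)
  have "ell2_on I = (\<Inter>k\<in>-I. {x. coord x k = 0})" by (auto simp: ell2_on_def)
  then show ?thesis
    by (auto intro!: closed_INT closed_Collect_eq linear_continuous_on lin)
qed

text \<open>Reduces completeness in a fibre to countably many unit vectors, so that the exceptional
  null sets, one per vector, can be united.\<close>

lemma ell2_on_subset_closure:
  assumes V: "csubspace V" and unit: "\<And>k. k \<in> I \<Longrightarrow> unit_ell2 k \<in> closure V"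
  shows "ell2_on I \<subseteq> closure V"
proof
  fix x assume x: "x \<in> ell2_on I"
  note sub = csubspace_closure[OF V]
  define y where "y n = (\<Sum>k<n. coord x k *\<^sub>C unit_ell2 k)" for n
  have coord_y: "coord (y n) i = (if i < n then coord x i else 0)" for n i
  proof -
    have "coord (y n) i = (\<Sum>k<n. coord x k * coord (unit_ell2 k) i)" unfolding y_def
      by (induction n) (auto simp: zero_ell2.rep_eq plus_ell2.rep_eq scaleC_ell2.rep_eq)
    also have "\<dots> = (\<Sum>k<n. if k = i then coord x i else 0)"
      by (rule sum.cong) (auto simp: unit_ell2.rep_eq)
    finally show ?thesis by simp
  qed
  have mem: "y n \<in> closure V" for n
    unfolding y_def
  proof (rule complex_vector.subspace_sum[OF sub])
    fix k
    show "coord x k *\<^sub>C unit_ell2 k \<in> closure V"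
      using unit[of k] x complex_vector.subspace_scale[OF sub] complex_vector.subspace_0[OF sub]
      by (cases "k \<in> I") (auto simp: ell2_on_def)
  qed
  have "(\<lambda>n. (norm (x - y n))\<^sup>2) \<longlonglongrightarrow> 0"
  proof -
    have "(norm (x - y n))\<^sup>2 = (norm x)\<^sup>2 - (\<Sum>k<n. (cmod (coord x k))\<^sup>2)" for n
    proof -
      have "(norm (x - y n))\<^sup>2 = (\<Sum>k. if k < n then 0 else (cmod (coord x k))\<^sup>2)"
        unfolding norm_ell2_power2 by (intro suminf_cong) (auto simp: minus_ell2.rep_eq coord_y)
      also have "\<dots> = (\<Sum>k. (cmod (coord x k))\<^sup>2 - (if k < n then (cmod (coord x k))\<^sup>2 else 0))"
        by (intro suminf_cong) auto
      also have "\<dots> = (norm x)\<^sup>2 - (\<Sum>k. if k < n then (cmod (coord x k))\<^sup>2 else 0)"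
        unfolding norm_ell2_power2
        by (intro suminf_diff[symmetric] coord_summable summable_finite[of "{..<n}"]) auto
      also have "(\<Sum>k. if k < n then (cmod (coord x k))\<^sup>2 else 0) = (\<Sum>k<n. (cmod (coord x k))\<^sup>2)"
        by (subst suminf_finite[of "{..<n}"]) auto
      finally show ?thesis .
    qed
    moreover have "(\<lambda>n. (norm x)\<^sup>2 - (\<Sum>k<n. (cmod (coord x k))\<^sup>2)) \<longlonglongrightarrow> (norm x)\<^sup>2 - (norm x)\<^sup>2"
      unfolding norm_ell2_power2 by (intro tendsto_diff tendsto_const summable_LIMSEQ coord_summable)
    ultimately show ?thesis by simp
  qed
  then have "(\<lambda>n. sqrt ((norm (x - y n))\<^sup>2)) \<longlonglongrightarrow> sqrt 0" by (intro tendsto_intros)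
  then have "(\<lambda>n. norm (y n - x)) \<longlonglongrightarrow> 0" by (simp add: norm_minus_commute)
  then have "y \<longlonglongrightarrow> x" by (simp add: LIM_zero_iff tendsto_norm_zero_iff)
  then show "x \<in> closure V"
    using mem closed_sequentially[OF closed_closure] by blast
qed

lemma borel_measurable_cnj [measurable]:
  "f \<in> borel_measurable M \<Longrightarrow> (\<lambda>x. cnj (f x)) \<in> borel_measurable M"
  by (rule measurable_compose[OF _ borel_measurable_continuous_onI]) (auto intro: continuous_intros)

section \<open>Fibrewise inner products\<close>

lemma integral_infsum:
  fixes f :: "'i::countable \<Rightarrow> 'a \<Rightarrow> 'b::{banach, second_countable_topology}"
  assumes int: "\<And>i. i \<in> A \<Longrightarrow> integrable M (f i)"
    and summ: "(\<lambda>i. LINT x|M. norm (f i x)) summable_on A"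
    and hs: "\<And>x. x \<in> space M \<Longrightarrow> ((\<lambda>i. f i x) has_sum g x) A"
  shows "integrable M g" "((\<lambda>i. integral\<^sup>L M (f i)) has_sum integral\<^sup>L M g) A"
proof -
  \<comment> \<open>The index set is transported into the natural numbers through
    \<open>to_nat\<close>; numbers outside the image get the zero function, which adds nothing to
    any of the sums.\<close>
  define h where "h n = (if n \<in> to_nat ` A then f (from_nat n) else (\<lambda>_. 0))" for n
  have bij: "bij_betw to_nat A (to_nat ` A)"
    by (simp add: bij_betw_def inj_on_def)
  have transf: "((\<lambda>i. \<phi> (f i)) has_sum s) A \<longleftrightarrow> ((\<lambda>n. \<phi> (h n)) has_sum s) UNIV"
    if "\<phi> (\<lambda>_. 0) = 0" for \<phi> :: "('a \<Rightarrow> 'b) \<Rightarrow> 'c::real_normed_vector" and s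
  proof -
    have "((\<lambda>i. \<phi> (f i)) has_sum s) A \<longleftrightarrow> ((\<lambda>i. \<phi> (h (to_nat i))) has_sum s) A"
      by (intro has_sum_cong) (simp add: h_def)
    also have "\<dots> \<longleftrightarrow> ((\<lambda>n. \<phi> (h n)) has_sum s) (to_nat ` A)"
      by (rule has_sum_reindex_bij_betw[OF bij])
    also have "\<dots> \<longleftrightarrow> ((\<lambda>n. \<phi> (h n)) has_sum s) UNIV"
      by (rule has_sum_cong_neutral) (auto simp: h_def that)
    finally show ?thesis .
  qed
  have int': "integrable M (h n)" for n using int by (auto simp: h_def)
  have "(\<lambda>n. LINT x|M. norm (h n x)) summable_on UNIV"
    using summ transf[of "\<lambda>u. LINT x|M. norm (u x)"] by (auto simp: summable_on_def)
  then have summ': "summable (\<lambda>n. LINT x|M. norm (h n x))"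
    by (rule summable_on_UNIV_nonneg_real_iff[THEN iffD1, rotated]) simp
  have "(\<integral>\<^sup>+x. (\<Sum>n. ennreal (norm (h n x))) \<partial>M) = (\<Sum>n. \<integral>\<^sup>+x. ennreal (norm (h n x)) \<partial>M)"
    using int' by (intro nn_integral_suminf) auto
  also have "\<dots> = (\<Sum>n. ennreal (LINT x|M. norm (h n x)))"
    using int' by (intro suminf_cong nn_integral_eq_integral) auto
  also have "\<dots> \<noteq> \<infinity>"
    using summ' by (simp add: ennreal_suminf_neq_top)
  finally have "AE x in M. (\<Sum>n. ennreal (norm (h n x))) \<noteq> \<infinity>"
    using int' by (intro nn_integral_PInf_AE) auto
  then have ae: "AE x in M. summable (\<lambda>n. norm (h n x))"
    by eventually_elim (auto intro: summable_suminf_not_top)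
  have gsum: "((\<lambda>n. h n x) has_sum g x) UNIV" if "x \<in> space M" for x
    using hs[OF that] transf[of "\<lambda>u. u x"] by simp
  have g: "(\<Sum>n. h n x) = g x" if "x \<in> space M" for x
    using has_sum_imp_sums[OF gsum[OF that]] by (simp add: sums_iff)
  show "integrable M g"
    using integrable_suminf[OF int' ae summ'] g by (simp cong: Bochner_Integration.integrable_cong)
  have sums: "(\<lambda>n. integral\<^sup>L M (h n)) sums integral\<^sup>L M g"
    using sums_integral[OF int' ae summ'] g by (simp cong: Bochner_Integration.integral_cong)
  have "summable (\<lambda>n. norm (integral\<^sup>L M (h n)))"
    by (rule summable_comparison_test'[OF summ']) (simp add: integral_norm_bound)
  then have "((\<lambda>n. integral\<^sup>L M (h n)) has_sum integral\<^sup>L M g) UNIV"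
    using sums by (rule norm_summable_imp_has_sum)
  then show "((\<lambda>i. integral\<^sup>L M (f i)) has_sum integral\<^sup>L M g) A"
    using transf[of "integral\<^sup>L M"] by simp
qed

locale multiplicity_measures =
  fixes \<mu> :: "enat \<Rightarrow> complex measure" and E :: "enat \<Rightarrow> complex set"
  assumes sets_mu: "1 \<le> j \<Longrightarrow> sets (\<mu> j) = sets borel"
    and sigma_finite_mu: "1 \<le> j \<Longrightarrow> sigma_finite_measure (\<mu> j)"
    and E_borel: "1 \<le> j \<Longrightarrow> E j \<in> sets borel"
    and E_null: "1 \<le> j \<Longrightarrow> emeasure (\<mu> j) (- E j) = 0"
    and disj: "disjoint_family_on E {1..}"
begin

abbreviation M :: "complex measure" where "M \<equiv> sum_measure \<mu>"

section \<open>All fibres over one scalar measure\<close>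

lemma borel_measurable_mu: "1 \<le> j \<Longrightarrow> borel_measurable (\<mu> j) = borel_measurable borel"
  using measurable_cong_sets[OF sets_mu refl] by auto

lemma borel_measurable_M [simp]: "borel_measurable M = borel_measurable borel"
  using measurable_cong_sets[OF sets_sum_measure refl] by auto

text \<open>Makes statements for different \<open>j\<close> comparable under one almost-everywhere
  quantifier. By disjointness \<open>E j\<close> lies in the null set \<open>- E i\<close> of every
  other \<open>\<mu> i\<close>, so only \<open>\<mu> j\<close> contributes to \<open>M\<close> on
  \<open>E j\<close>.\<close>

lemma mu_eq_density:
  assumes j: "1 \<le> j"
  shows "\<mu> j = density M (\<lambda>z. ennreal (indicator (E j) z))"
proof (rule measure_eqI)
  show "sets (\<mu> j) = sets (density M (\<lambda>z. ennreal (indicator (E j) z)))"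
    using j by (simp add: sets_mu sets_sum_measure)
  fix B assume "B \<in> sets (\<mu> j)"
  then have B: "B \<in> sets borel" and EB: "E j \<inter> B \<in> sets borel" using j E_borel by (auto simp: sets_mu)
  have "emeasure (density M (\<lambda>z. ennreal (indicator (E j) z))) B =
      (\<integral>\<^sup>+z. ennreal (indicator (E j) z) * indicator B z \<partial>M)"
    using B E_borel[OF j] by (intro emeasure_density) (auto simp: sets_sum_measure)
  also have "\<dots> = (\<integral>\<^sup>+z. indicator (E j \<inter> B) z \<partial>M)"
    by (intro nn_integral_cong) (auto simp: indicator_def)
  also have "\<dots> = (\<integral>\<^sup>+i. emeasure (\<mu> i) (E j \<inter> B) \<partial>count_space {1..})"
    using EB by (simp add: sets_sum_measure emeasure_sum_measure sets_mu)
  also have "\<dots> = (\<integral>\<^sup>+i. emeasure (\<mu> j) B * indicator {j} i \<partial>count_space {1..})"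
  proof (rule nn_integral_cong)
    fix i :: enat assume "i \<in> space (count_space {1..})"
    then have i: "1 \<le> i" by simp
    show "emeasure (\<mu> i) (E j \<inter> B) = emeasure (\<mu> j) B * indicator {j} i"
    proof (cases "i = j")
      case True
      have "emeasure (\<mu> j) (E j \<inter> B) = emeasure (\<mu> j) B"
        by (rule emeasure_eq_AE)
          (use E_null[OF j] E_borel[OF j] B j EB in \<open>auto simp: sets_mu intro!: AE_I[of _ _ "- E j"]\<close>)
      then show ?thesis using True by simp
    next
      case False
      then have "E j \<inter> B \<subseteq> - E i" using disj i j unfolding disjoint_family_on_def by fastforce
      then have "emeasure (\<mu> i) (E j \<inter> B) \<le> emeasure (\<mu> i) (- E i)"
        using i E_borel by (intro emeasure_mono) (auto simp: sets_mu)
      then show ?thesis using False E_null[OF i] by simp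
    qed
  qed
  also have "\<dots> = emeasure (\<mu> j) B"
    using j by (simp add: nn_integral_cmult)
  finally show "emeasure (\<mu> j) B = emeasure (density M (\<lambda>z. ennreal (indicator (E j) z))) B" ..
qed

lemma indicator_E_measurable: "1 \<le> j \<Longrightarrow> (indicator (E j) :: complex \<Rightarrow> real) \<in> borel_measurable M"
  using borel_measurable_indicator[OF E_borel] by simp

lemma AE_mu_iff:
  assumes j: "1 \<le> j"
  shows "(AE z in \<mu> j. P z) \<longleftrightarrow> (AE z in M. z \<in> E j \<longrightarrow> P z)"
proof -
  have "(AE z in \<mu> j. P z) \<longleftrightarrow> (AE z in M. 0 < ennreal (indicator (E j) z) \<longrightarrow> P z)"
    unfolding mu_eq_density[OF j] using indicator_E_measurable[OF j] by (intro AE_density) simp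
  then show ?thesis by (simp add: indicator_def)
qed

lemma AE_in_E: "1 \<le> j \<Longrightarrow> AE z in \<mu> j. z \<in> E j"
  by (simp add: AE_mu_iff)

lemma integrable_mu_iff:
  fixes f :: "complex \<Rightarrow> 'b::{banach, second_countable_topology}"
  assumes "1 \<le> j" "f \<in> borel_measurable borel"
  shows "integrable (\<mu> j) f \<longleftrightarrow> integrable M (\<lambda>z. indicator (E j) z *\<^sub>R f z)"
  unfolding mu_eq_density[OF assms(1)] using assms indicator_E_measurable
  by (intro integrable_density) auto

lemma integral_mu:
  fixes f :: "complex \<Rightarrow> 'b::{banach, second_countable_topology}"
  assumes "1 \<le> j" "f \<in> borel_measurable borel"
  shows "integral\<^sup>L (\<mu> j) f = (LINT z|M. indicator (E j) z *\<^sub>R f z)"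
  unfolding mu_eq_density[OF assms(1)] using assms indicator_E_measurable
  by (intro integral_density) auto

lemma AE_sum_measure_in_E: "AE z in M. \<exists>j\<ge>1. z \<in> E j"
proof (rule AE_I)
  let ?N = "- (\<Union>j\<in>{1..}. E j)"
  show N: "?N \<in> sets M" using E_borel
    by (auto simp: sets_sum_measure intro!: borel_comp sets.countable_UN')
  then have "emeasure M ?N = (\<integral>\<^sup>+j. emeasure (\<mu> j) ?N \<partial>count_space {1..})"
    by (intro emeasure_sum_measure) (auto simp: sets_mu sets_sum_measure)
  also have "\<dots> = (\<integral>\<^sup>+j. 0 \<partial>count_space ({1..} :: enat set))"
  proof (rule nn_integral_cong)
    fix j :: enat assume "j \<in> space (count_space {1..})"
    then have j: "1 \<le> j" by simp
    then have "emeasure (\<mu> j) ?N \<le> emeasure (\<mu> j) (- E j)"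
      using E_borel by (intro emeasure_mono) (auto simp: sets_mu)
    then show "emeasure (\<mu> j) ?N = 0" using E_null[OF j] by simp
  qed
  finally show "emeasure M ?N = 0" by simp
qed auto

text \<open>The condition may vary with \<open>j\<close> because it is asked only on the matching
  \<open>E j\<close>; the exceptional null sets unite because \<open>enat\<close> is
  countable.\<close>

lemma AE_sum_measureI:
  assumes "\<And>j. 1 \<le> j \<Longrightarrow> AE z in \<mu> j. P j z"
  shows "AE z in M. \<exists>j\<ge>1. z \<in> E j \<and> P j z"
proof -
  have "AE z in M. 1 \<le> j \<longrightarrow> z \<in> E j \<longrightarrow> P j z" for j
    using assms[of j] by (cases "1 \<le> j") (auto simp: AE_mu_iff)
  then have "AE z in M. \<forall>j. 1 \<le> j \<longrightarrow> z \<in> E j \<longrightarrow> P j z"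
    by (simp add: AE_all_countable)
  then show ?thesis using AE_sum_measure_in_E by eventually_elim auto
qed

lemma dsum_L2_measurable:
  assumes "F \<in> dsum_L2 \<mu>" "1 \<le> j"
  shows "(\<lambda>z. coord (F j z) k) \<in> borel_measurable borel"
proof (cases "k \<in> Omega j")
  case True
  then show ?thesis using assms by (auto simp: dsum_L2_def borel_measurable_mu)
next
  case False
  then have "(\<lambda>z. coord (F j z) k) = (\<lambda>_. 0)" using assms by (auto simp: dsum_L2_def ell2_on_def)
  then show ?thesis by simp
qed

lemma dsum_L2_ell2_on: "F \<in> dsum_L2 \<mu> \<Longrightarrow> 1 \<le> j \<Longrightarrow> F j z \<in> ell2_on (Omega j)"
  by (auto simp: dsum_L2_def)

text \<open>Interchanging the sum over all components with the integral. Domination comes from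
  \<open>\<bar>a * b\<bar> \<le> a\<^sup>2 + b\<^sup>2\<close> and the summability built into
  \<open>dsum_L2\<close>.\<close>

lemma fibre_cinner_integral:
  assumes F: "F \<in> dsum_L2 \<mu>" and G: "G \<in> dsum_L2 \<mu>"
  shows "integrable M (fibre_cinner E F G)"
    and "integral\<^sup>L M (fibre_cinner E F G) = dsum_cinner \<mu> F G"
proof -
  let ?\<Sigma> = "SIGMA j:{1..}. Omega j"
  define a where "a p z = coord (F (fst p) z) (snd p) * cnj (coord (G (fst p) z) (snd p))" for p z
  define \<phi> where "\<phi> p z = indicator (E (fst p)) z *\<^sub>R a p z" for p z
  have \<phi>: "\<phi> p = (\<lambda>z. indicator (E (fst p)) z *\<^sub>R a p z)" for p
    by (simp add: \<phi>_def fun_eq_iff)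
  have meas: "a p \<in> borel_measurable borel" if "p \<in> ?\<Sigma>" for p
    unfolding a_def using that
    by (intro borel_measurable_times borel_measurable_cnj dsum_L2_measurable F G) auto
  have sq: "integrable (\<mu> (fst p)) (\<lambda>z. (cmod (coord (H (fst p) z) (snd p)))\<^sup>2)" if "p \<in> ?\<Sigma>" "H \<in> dsum_L2 \<mu>" for p H
    using that by (auto simp: dsum_L2_def)
  have le: "cmod (a p z) \<le> (cmod (coord (F (fst p) z) (snd p)))\<^sup>2 + (cmod (coord (G (fst p) z) (snd p)))\<^sup>2" for p z
  proof -
    have "2 * (cmod (coord (F (fst p) z) (snd p)) * cmod (coord (G (fst p) z) (snd p))) \<le>
      (cmod (coord (F (fst p) z) (snd p)))\<^sup>2 + (cmod (coord (G (fst p) z) (snd p)))\<^sup>2"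
      using sum_squares_bound[of "cmod (coord (F (fst p) z) (snd p))" "cmod (coord (G (fst p) z) (snd p))"]
      by simp
    moreover have "0 \<le> cmod (coord (F (fst p) z) (snd p)) * cmod (coord (G (fst p) z) (snd p))" by simp
    ultimately show ?thesis unfolding a_def norm_mult complex_mod_cnj by linarith
  qed
  have int_a: "integrable (\<mu> (fst p)) (a p)" if "p \<in> ?\<Sigma>" for p
  proof (rule Bochner_Integration.integrable_bound)
    show "integrable (\<mu> (fst p)) (\<lambda>z. (cmod (coord (F (fst p) z) (snd p)))\<^sup>2 + (cmod (coord (G (fst p) z) (snd p)))\<^sup>2)"
      by (intro Bochner_Integration.integrable_add sq that F G)
    show "a p \<in> borel_measurable (\<mu> (fst p))"
      using meas[OF that] that by (auto simp: borel_measurable_mu)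
  qed (use le in auto)
  have int: "integrable M (\<phi> p)" if "p \<in> ?\<Sigma>" for p
    using int_a[OF that] meas[OF that] that integrable_mu_iff[of "fst p" "a p"] by (auto simp: \<phi>)
  have int_eq: "integral\<^sup>L M (\<phi> p) = integral\<^sup>L (\<mu> (fst p)) (a p)" if "p \<in> ?\<Sigma>" for p
    using meas[OF that] that integral_mu[of "fst p" "a p"] by (auto simp: \<phi>)
  have norm_eq: "(LINT z|M. norm (\<phi> p z)) = (LINT z|\<mu> (fst p). norm (a p z))" if "p \<in> ?\<Sigma>" for p
    using meas[OF that] that integral_mu[of "fst p" "\<lambda>z. norm (a p z)"] by (auto simp: \<phi>_def)
  have summ: "(\<lambda>p. LINT z|M. norm (\<phi> p z)) summable_on ?\<Sigma>"
  proof (rule summable_on_comparison_test)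
    have "(\<lambda>p. LINT z|\<mu> (fst p). (cmod (coord (H (fst p) z) (snd p)))\<^sup>2) summable_on ?\<Sigma>" if "H \<in> dsum_L2 \<mu>" for H
      using that by (simp add: dsum_L2_def case_prod_unfold)
    then show "(\<lambda>p. (LINT z|\<mu> (fst p). (cmod (coord (F (fst p) z) (snd p)))\<^sup>2) + (LINT z|\<mu> (fst p). (cmod (coord (G (fst p) z) (snd p)))\<^sup>2)) summable_on ?\<Sigma>"
      using F G by (intro summable_on_add) auto
    fix p assume p: "p \<in> ?\<Sigma>"
    have "(LINT z|\<mu> (fst p). norm (a p z)) \<le> (LINT z|\<mu> (fst p). (cmod (coord (F (fst p) z) (snd p)))\<^sup>2 + (cmod (coord (G (fst p) z) (snd p)))\<^sup>2)"
      using int_a[OF p] le by (intro integral_mono Bochner_Integration.integrable_add sq p F G) auto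
    also have "\<dots> = (LINT z|\<mu> (fst p). (cmod (coord (F (fst p) z) (snd p)))\<^sup>2) + (LINT z|\<mu> (fst p). (cmod (coord (G (fst p) z) (snd p)))\<^sup>2)"
      by (intro Bochner_Integration.integral_add sq p F G)
    finally show "(LINT z|M. norm (\<phi> p z)) \<le> (LINT z|\<mu> (fst p). (cmod (coord (F (fst p) z) (snd p)))\<^sup>2) + (LINT z|\<mu> (fst p). (cmod (coord (G (fst p) z) (snd p)))\<^sup>2)"
      using norm_eq[OF p] by simp
  qed simp
  \<comment> \<open>At a fixed point at most one \<open>E j\<close> is active, so the double sum
    collapses to the inner product of a single fibre.\<close>
  have hs: "((\<lambda>p. \<phi> p z) has_sum fibre_cinner E F G z) ?\<Sigma>" for z
  proof (cases "\<exists>j\<ge>1. z \<in> E j")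
    case True
    then obtain j where j: "1 \<le> j" "z \<in> E j" by blast
    have other: "z \<notin> E i" if "1 \<le> i" "i \<noteq> j" for i
      using disj j that unfolding disjoint_family_on_def by auto
    have "((\<lambda>k. \<phi> (j, k) z) has_sum fibre_cinner E F G z) (Omega j)"
      using cinner_ell2_has_sum[OF dsum_L2_ell2_on[OF F j(1)], of z "G j z"] j
      by (simp add: \<phi>_def a_def fibre_cinner_eq[OF disj j])
    moreover have "bij_betw (Pair j) (Omega j) ({j} \<times> Omega j)"
      by (auto simp: bij_betw_def inj_on_def)
    ultimately have "((\<lambda>p. \<phi> p z) has_sum fibre_cinner E F G z) ({j} \<times> Omega j)"
      using has_sum_reindex_bij_betw[of "Pair j" "Omega j" "{j} \<times> Omega j" "\<lambda>p. \<phi> p z"] by simp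
    moreover have "\<phi> p z = 0" if "p \<in> ?\<Sigma> - {j} \<times> Omega j" for p
    proof -
      have "z \<notin> E (fst p)" using that by (intro other) auto
      then show ?thesis by (simp add: \<phi>_def)
    qed
    ultimately show ?thesis
      by (rule has_sum_cong_neutral[THEN iffD1, rotated -1]) (use j in auto)
  next
    case False
    then show ?thesis
      by (subst fibre_cinner_outside) (auto simp: \<phi>_def intro!: has_sum_0)
  qed
  note res = integral_infsum[OF int summ hs]
  show "integrable M (fibre_cinner E F G)" using res(1) by (simp add: eta_contract_eq)
  have "((\<lambda>p. integral\<^sup>L (\<mu> (fst p)) (a p)) has_sum integral\<^sup>L M (fibre_cinner E F G)) ?\<Sigma>"
    using res(2) int_eq by (subst has_sum_cong[where g = "\<lambda>p. integral\<^sup>L M (\<phi> p)"]) auto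
  then show "integral\<^sup>L M (fibre_cinner E F G) = dsum_cinner \<mu> F G"
    unfolding dsum_cinner_def a_def case_prod_unfold by (rule infsumI[symmetric])
qed

lemma dsum_L2_scaleC:
  assumes F: "F \<in> dsum_L2 \<mu>" and m: "m \<in> borel_measurable borel" and C: "\<And>z. cmod (m z) \<le> C"
  shows "(\<lambda>j z. m z *\<^sub>C F j z) \<in> dsum_L2 \<mu>"
proof -
  let ?G = "\<lambda>j z. m z *\<^sub>C F j z" and ?\<Sigma> = "SIGMA j:{1..}. Omega j"
  have C2: "(cmod (m z))\<^sup>2 \<le> C\<^sup>2" for z using C by (intro power_mono) auto
  have on: "?G j z \<in> ell2_on (Omega j)" if "1 \<le> j" for j z
    using dsum_L2_ell2_on[OF F that] csubspace_ell2_on complex_vector.subspace_scale by blast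
  have meas: "(\<lambda>z. coord (?G j z) k) \<in> borel_measurable (\<mu> j)" if "1 \<le> j" for j k
    using dsum_L2_measurable[OF F that] m that by (simp add: borel_measurable_mu scaleC_ell2.rep_eq)
  have intF: "integrable (\<mu> j) (\<lambda>z. (cmod (coord (F j z) k))\<^sup>2)" if "1 \<le> j" "k \<in> Omega j" for j k
    using F that by (auto simp: dsum_L2_def)
  have le: "(cmod (coord (?G j z) k))\<^sup>2 \<le> C\<^sup>2 * (cmod (coord (F j z) k))\<^sup>2" for j k z
    using C2 by (simp add: scaleC_ell2.rep_eq norm_mult power_mult_distrib mult_right_mono)
  have int: "integrable (\<mu> j) (\<lambda>z. (cmod (coord (?G j z) k))\<^sup>2)" if "1 \<le> j" "k \<in> Omega j" for j k
  proof (rule Bochner_Integration.integrable_bound)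
    show "integrable (\<mu> j) (\<lambda>z. C\<^sup>2 * (cmod (coord (F j z) k))\<^sup>2)" using intF[OF that] by simp
    show "(\<lambda>z. (cmod (coord (?G j z) k))\<^sup>2) \<in> borel_measurable (\<mu> j)" using meas[OF that(1), of k] by measurable
  qed (use le in auto)
  have "(\<lambda>(j, k). LINT z|\<mu> j. (cmod (coord (?G j z) k))\<^sup>2) summable_on ?\<Sigma>"
  proof (rule summable_on_comparison_test)
    show "(\<lambda>p. C\<^sup>2 * (case p of (j, k) \<Rightarrow> LINT z|\<mu> j. (cmod (coord (F j z) k))\<^sup>2)) summable_on ?\<Sigma>"
      using F by (intro summable_on_cmult_right) (simp add: dsum_L2_def)
    fix p assume "p \<in> ?\<Sigma>"
    then obtain j k where p: "p = (j, k)" and jk: "1 \<le> j" "k \<in> Omega j" by auto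
    have "(LINT z|\<mu> j. (cmod (coord (?G j z) k))\<^sup>2) \<le> (LINT z|\<mu> j. C\<^sup>2 * (cmod (coord (F j z) k))\<^sup>2)"
      using int[OF jk] intF[OF jk] le by (intro integral_mono) auto
    then show "(case p of (j, k) \<Rightarrow> LINT z|\<mu> j. (cmod (coord (?G j z) k))\<^sup>2) \<le> C\<^sup>2 * (case p of (j, k) \<Rightarrow> LINT z|\<mu> j. (cmod (coord (F j z) k))\<^sup>2)"
      using p by simp
  qed auto
  then show ?thesis unfolding dsum_L2_def using on meas int by blast
qed

text \<open>The test vectors of the proof: constant unit fields over sets of finite measure. They
  detect mass of \<open>\<mu> j\<close> near a point and, later, carry each unit vector of a fibre
  back to the Hilbert space.\<close>

lemma dsum_L2_unit:
  assumes j: "1 \<le> j" and k: "k \<in> Omega j" and S: "S \<in> sets borel" "emeasure (\<mu> j) S < \<infinity>"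
  shows "(\<lambda>i z. if i = j \<and> z \<in> S then unit_ell2 k else 0) \<in> dsum_L2 \<mu>" (is "?F \<in> _")
proof -
  have F: "(cmod (coord (?F i z) l))\<^sup>2 = (if i = j \<and> l = k then indicator S z else 0)" for i z l
    by (auto simp: zero_ell2.rep_eq unit_ell2.rep_eq)
  have F': "coord (?F i z) l = (if i = j \<and> l = k then indicator S z else 0)" for i z l
    by (auto simp: zero_ell2.rep_eq unit_ell2.rep_eq)
  have summ: "(\<lambda>(i, l). LINT z|\<mu> i. (cmod (coord (?F i z) l))\<^sup>2) summable_on (SIGMA j:{1..}. Omega j)"
  proof (rule summable_on_cong_neutral[THEN iffD1])
    show "(\<lambda>(i, l). LINT z|\<mu> i. (cmod (coord (?F i z) l))\<^sup>2) summable_on {(j, k)}" by simp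
  next
    fix p assume "p \<in> (SIGMA j:{1..}. Omega j) - {(j, k)}"
    then have "\<not> (fst p = j \<and> snd p = k)" by (cases p) auto
    then show "(case p of (i, l) \<Rightarrow> LINT z|\<mu> i. (cmod (coord (?F i z) l))\<^sup>2) = 0"
      by (auto simp: F case_prod_unfold)
  qed (use j k in auto)
  have on: "?F i z \<in> ell2_on (Omega i)" for i z
    using k by (auto simp: ell2_on_def F')
  have "integrable (\<mu> j) (indicator S :: complex \<Rightarrow> real)"
    using S j by (simp add: sets_mu)
  moreover have "(indicator S :: complex \<Rightarrow> complex) \<in> borel_measurable (\<mu> j)"
    using S j by (simp add: borel_measurable_mu borel_measurable_indicator)
  ultimately have meas: "(\<lambda>z. coord (?F i z) l) \<in> borel_measurable (\<mu> i) \<and> integrable (\<mu> i) (\<lambda>z. (cmod (coord (?F i z) l))\<^sup>2)" for i l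
    unfolding F unfolding F' by (cases "i = j \<and> l = k") auto
  show ?thesis
    unfolding dsum_L2_def mem_Collect_eq
    by (intro conjI allI impI ballI summ on meas[THEN conjunct1] meas[THEN conjunct2])
qed

text \<open>Test fields exist only over sets of finite measure; sigma-finiteness passes from those
  to arbitrary Borel sets.\<close>

lemma emeasure_eq_0_if_finite_parts:
  assumes j: "1 \<le> j" and S: "S \<in> sets borel"
    and null: "\<And>T. T \<in> sets borel \<Longrightarrow> T \<subseteq> S \<Longrightarrow> emeasure (\<mu> j) T < \<infinity> \<Longrightarrow> emeasure (\<mu> j) T = 0"
  shows "emeasure (\<mu> j) S = 0"
proof -
  interpret sigma_finite_measure "\<mu> j" using sigma_finite_mu[OF j] .
  obtain B :: "nat \<Rightarrow> complex set" where B: "range B \<subseteq> sets (\<mu> j)" "(\<Union>i. B i) = space (\<mu> j)" "\<And>i. emeasure (\<mu> j) (B i) \<noteq> \<infinity>"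
    using sigma_finite by metis
  have sp: "space (\<mu> j) = UNIV" using sets_eq_imp_space_eq[OF sets_mu[OF j]] by simp
  have "S \<inter> B i \<in> null_sets (\<mu> j)" for i
  proof -
    have Bi: "B i \<in> sets borel" using B(1) j by (auto simp: sets_mu)
    have "emeasure (\<mu> j) (S \<inter> B i) \<le> emeasure (\<mu> j) (B i)"
      using Bi j by (intro emeasure_mono) (auto simp: sets_mu)
    also have "\<dots> < \<infinity>" using B(3) by (simp add: top.not_eq_extremum)
    finally have "emeasure (\<mu> j) (S \<inter> B i) = 0" using Bi S by (intro null) auto
    then show ?thesis using Bi S j by (auto simp: null_sets_def sets_mu)
  qed
  then have "(\<Union>i. S \<inter> B i) \<in> null_sets (\<mu> j)" by blast
  moreover have "(\<Union>i. S \<inter> B i) = S" using B(2) sp by auto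
  ultimately show ?thesis by auto
qed

end

section \<open>Multiplication operators and the spectrum\<close>

locale spectral_model = multiplicity_measures \<mu> E
  for \<mu> :: "enat \<Rightarrow> complex measure" and E :: "enat \<Rightarrow> complex set" +
  fixes A :: "'a::chilbert_space \<Rightarrow> 'a" and U :: "'a \<Rightarrow> enat \<Rightarrow> complex \<Rightarrow> ell2"
  assumes A: "bounded_clinear A"
    and unitary: "unitary_onto_dsum \<mu> U"
    and U_A: "dsum_eq \<mu> (U (A f)) (\<lambda>j z. z *\<^sub>C U f j z)"
begin

lemma U_mem: "U f \<in> dsum_L2 \<mu>"
  and U_add: "dsum_eq \<mu> (U (f + g)) (\<lambda>j z. U f j z + U g j z)"
  and U_scaleC: "dsum_eq \<mu> (U (c *\<^sub>C f)) (\<lambda>j z. c *\<^sub>C U f j z)"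
  and U_cinner: "dsum_cinner \<mu> (U f) (U g) = cinner f g"
  and U_surj: "F \<in> dsum_L2 \<mu> \<Longrightarrow> \<exists>f. dsum_eq \<mu> (U f) F"
  using unitary unfolding unitary_onto_dsum_def by blast+

abbreviation fib :: "'a \<Rightarrow> 'a \<Rightarrow> complex \<Rightarrow> complex" where
  "fib f g \<equiv> fibre_cinner E (U f) (U g)"

lemma integrable_fib: "integrable M (fib f g)"
  and integral_fib: "integral\<^sup>L M (fib f g) = cinner f g"
  using fibre_cinner_integral[OF U_mem U_mem] by (simp_all add: U_cinner)

lemma fib_measurable: "fib f g \<in> borel_measurable borel"
  using borel_measurable_integrable[OF integrable_fib] by simp

lemma norm_eq_integral: "(norm f)\<^sup>2 = (LINT z|M. cmod (fib f f z))"
proof -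
  have "complex_of_real ((norm f)\<^sup>2) = (LINT z|M. fib f f z)"
    by (simp only: integral_fib cinner_self)
  also have "\<dots> = (LINT z|M. complex_of_real (cmod (fib f f z)))"
    using fibre_cinner_self[OF disj] by (intro Bochner_Integration.integral_cong) auto
  also have "\<dots> = complex_of_real (LINT z|M. cmod (fib f f z))"
    by (rule integral_complex_of_real)
  finally show ?thesis by (simp only: of_real_eq_iff)
qed

lemma AE_fibre_cong:
  assumes "dsum_eq \<mu> F F'" "dsum_eq \<mu> G G'"
  shows "AE z in M. fibre_cinner E F G z = fibre_cinner E F' G' z"
proof -
  have "AE z in M. \<exists>j\<ge>1. z \<in> E j \<and> (F j z = F' j z \<and> G j z = G' j z)"
    by (rule AE_sum_measureI) (use assms in \<open>auto simp: dsum_eq_def\<close>)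
  then show ?thesis by eventually_elim (auto simp: fibre_cinner_eq[OF disj])
qed

lemma dsum_eq_refl: "dsum_eq \<mu> F F"
  by (simp add: dsum_eq_def)

lemma AE_fib_scaleC_left:
  assumes "dsum_eq \<mu> (U g) (\<lambda>j z. m z *\<^sub>C U f j z)"
  shows "AE z in M. fib g h z = m z * fib f h z"
  using AE_fibre_cong[OF assms dsum_eq_refl[of "U h"]] by (simp add: fibre_cinner_scaleC_left[OF disj])

lemma AE_fib_scaleC:
  assumes "dsum_eq \<mu> (U g) (\<lambda>j z. m z *\<^sub>C U f j z)" "dsum_eq \<mu> (U g') (\<lambda>j z. n z *\<^sub>C U f' j z)"
  shows "AE z in M. fib g g' z = m z * cnj (n z) * fib f f' z"
  using AE_fibre_cong[OF assms] by (simp add: fibre_cinner_scaleC[OF disj])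

text \<open>Inner products with every \<open>h\<close> are integrals of fibre products, so they
  cannot distinguish \<open>f\<close> from \<open>g\<close>. Operator identities can therefore be
  verified fibre by fibre, almost everywhere.\<close>

lemma U_inj:
  assumes "dsum_eq \<mu> (U f) (U g)"
  shows "f = g"
proof -
  have "cinner f h = cinner g h" for h
    unfolding integral_fib[symmetric]
    using AE_fibre_cong[OF assms dsum_eq_refl[of "U h"]] fib_measurable
    by (intro integral_cong_AE) auto
  then have "cinner (f - g) (f - g) = 0" by (simp add: cinner_diff_left)
  then show ?thesis by (simp add: cinner_self)
qed

lemma U_zero: "dsum_eq \<mu> (U 0) (\<lambda>j z. 0)"
  using U_scaleC[of 0 0] by simp

lemma U_minus_scaleC: "dsum_eq \<mu> (U (f - c *\<^sub>C g)) (\<lambda>j z. U f j z - c *\<^sub>C U g j z)"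
proof -
  have "f - c *\<^sub>C g = f + (- c) *\<^sub>C g" by simp
  then have "dsum_eq \<mu> (U (f - c *\<^sub>C g)) (\<lambda>j z. U f j z + U ((- c) *\<^sub>C g) j z)"
    using U_add[of f "(- c) *\<^sub>C g"] by simp
  moreover note U_scaleC[of "- c" g]
  ultimately show ?thesis unfolding dsum_eq_def
    by (intro allI impI) (auto elim!: allE intro: AE_mp[rotated])
qed

lemma U_diff: "dsum_eq \<mu> (U (f - g)) (\<lambda>j z. U f j z - U g j z)"
  using U_minus_scaleC[of f 1 g] by simp

text \<open>Bounded Borel functions of \<open>A\<close>, pulled back through the model. Surjectivity
  of \<open>U\<close> provides some preimage for each \<open>f\<close>; linearity of the choice is
  then forced by \<open>U_inj\<close>.\<close>

lemma ex_multiplication: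
  assumes m: "m \<in> borel_measurable borel" and C: "\<And>z. cmod (m z) \<le> C"
  obtains B where "bounded_clinear B" "\<And>f. dsum_eq \<mu> (U (B f)) (\<lambda>j z. m z *\<^sub>C U f j z)"
proof -
  have "\<forall>f. \<exists>g. dsum_eq \<mu> (U g) (\<lambda>j z. m z *\<^sub>C U f j z)"
    using U_surj[OF dsum_L2_scaleC[OF U_mem m C]] by blast
  then obtain B where B: "\<And>f. dsum_eq \<mu> (U (B f)) (\<lambda>j z. m z *\<^sub>C U f j z)" by metis
  have add: "B (f + g) = B f + B g" for f g
  proof (rule U_inj, unfold dsum_eq_def, intro allI impI)
    fix j :: enat assume j: "1 \<le> j"
    note B' = B[unfolded dsum_eq_def, rule_format, OF j]
    show "AE z in \<mu> j. U (B (f + g)) j z = U (B f + B g) j z"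
      using B'[of f] B'[of g] B'[of "f + g"] U_add[of f g, unfolded dsum_eq_def, rule_format, OF j]
        U_add[of "B f" "B g", unfolded dsum_eq_def, rule_format, OF j]
      by eventually_elim (simp add: scaleC_add_right)
  qed
  have scale: "B (c *\<^sub>C f) = c *\<^sub>C B f" for c f
  proof (rule U_inj, unfold dsum_eq_def, intro allI impI)
    fix j :: enat assume j: "1 \<le> j"
    note B' = B[unfolded dsum_eq_def, rule_format, OF j]
    show "AE z in \<mu> j. U (B (c *\<^sub>C f)) j z = U (c *\<^sub>C B f) j z"
      using B'[of f] B'[of "c *\<^sub>C f"] U_scaleC[of c f, unfolded dsum_eq_def, rule_format, OF j]
        U_scaleC[of c "B f", unfolded dsum_eq_def, rule_format, OF j]
      by eventually_elim (simp add: scaleC_scaleC mult.commute)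
  qed
  have C0: "C \<ge> 0" using C[of 0] norm_ge_zero order_trans by blast
  have "bounded_linear B"
  proof (rule bounded_linear_intro)
    show "B (r *\<^sub>R f) = r *\<^sub>R B f" for r f by (metis scale scaleC_of_real)
    show "norm (B f) \<le> norm f * C" for f
    proof -
      have "(norm (B f))\<^sup>2 = (LINT z|M. cmod (fib (B f) (B f) z))" by (rule norm_eq_integral)
      also have "\<dots> \<le> (LINT z|M. C\<^sup>2 * cmod (fib f f z))"
      proof (rule integral_mono_AE)
        show "AE z in M. cmod (fib (B f) (B f) z) \<le> C\<^sup>2 * cmod (fib f f z)"
          using AE_fib_scaleC[OF B[of f] B[of f]]
        proof eventually_elim
          case (elim z)
          have "cmod (m z) * cmod (m z) \<le> C * C" using C[of z] C0 by (intro mult_mono) auto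
          then show ?case unfolding elim norm_mult complex_mod_cnj power2_eq_square
            by (intro mult_right_mono) auto
        qed
      qed (use integrable_fib in auto)
      also have "\<dots> = (C * norm f)\<^sup>2" by (simp add: norm_eq_integral power_mult_distrib)
      finally have "norm (B f) \<le> C * norm f" by (rule power2_le_imp_le) (use C0 in simp)
      then show ?thesis by (simp add: mult.commute)
    qed
  qed (rule add)
  then have "bounded_clinear B" by (simp add: bounded_clinear_def scale)
  then show thesis using B that by blast
qed

section \<open>Location of the spectrum\<close>

lemma U_A_diff: "dsum_eq \<mu> (U (A f - w *\<^sub>C f)) (\<lambda>j z. (z - w) *\<^sub>C U f j z)"
  unfolding dsum_eq_def
proof (intro allI impI)
  fix j :: enat assume j: "1 \<le> j"
  show "AE z in \<mu> j. U (A f - w *\<^sub>C f) j z = (z - w) *\<^sub>C U f j z"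
    using U_minus_scaleC[of "A f" w f, unfolded dsum_eq_def, rule_format, OF j]
      U_A[of f, unfolded dsum_eq_def, rule_format, OF j]
    by eventually_elim (simp add: complex_vector.scale_left_diff_distrib)
qed

text \<open>If \<open>\<mu> j\<close> had mass in the ball, a field \<open>f\<close> supported there
  would violate the lower bound, because the multiplier \<open>z - w\<close> has modulus below
  \<open>c\<close> on it.\<close>

lemma emeasure_ball_eq_0:
  assumes c: "c > 0" and below: "\<And>f. c * norm f \<le> norm (A f - w *\<^sub>C f)" and j: "1 \<le> j"
  shows "emeasure (\<mu> j) (ball w c) = 0"
proof (rule emeasure_eq_0_if_finite_parts[OF j])
  fix T assume T: "T \<in> sets borel" "T \<subseteq> ball w c" "emeasure (\<mu> j) T < \<infinity>"
  \<comment> \<open>Coordinate 1 belongs to \<open>Omega j\<close> for every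
    \<open>j \<ge> 1\<close>, infinity included, so one test vector serves all
    multiplicities.\<close>
  have k: "1 \<in> Omega j" using j by (simp add: Omega_def one_enat_def)
  define F where "F = (\<lambda>i z. if i = j \<and> z \<in> T then unit_ell2 1 else 0)"
  have "F \<in> dsum_L2 \<mu>" unfolding F_def by (rule dsum_L2_unit[OF j k T(1,3)])
  then obtain f where f: "dsum_eq \<mu> (U f) F" using U_surj by blast
  let ?I = "indicator (E j \<inter> T) :: complex \<Rightarrow> real"
  have F: "fibre_cinner E F F z = complex_of_real (?I z)" for z
  proof (cases "\<exists>i\<ge>1. z \<in> E i")
    case True
    then obtain i where i: "1 \<le> i" "z \<in> E i" by blast
    have "i = j" if "z \<in> E j"
      using disj i j that unfolding disjoint_family_on_def by fastforce
    then show ?thesis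
      using i by (auto simp: fibre_cinner_eq[OF disj i] F_def cinner_self indicator_def)
  next
    case False
    then show ?thesis using j by (subst fibre_cinner_outside) auto
  qed
  have ff: "AE z in M. fib f f z = complex_of_real (?I z)"
    using AE_fibre_cong[OF f f] by (simp add: F)
  let ?g = "A f - w *\<^sub>C f"
  have gg: "AE z in M. fib ?g ?g z = (z - w) * cnj (z - w) * fib f f z"
    by (rule AE_fib_scaleC[OF U_A_diff U_A_diff])
  \<comment> \<open>The integrand of
    \<open>c\<^sup>2 * (norm f)\<^sup>2 - (norm ?g)\<^sup>2\<close>: nonnegative almost everywhere
    by the position of \<open>T\<close>, of nonpositive integral by the lower bound, hence
    zero.\<close>
  define u where "u z = c\<^sup>2 * cmod (fib f f z) - cmod (fib ?g ?g z)" for z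
  have u: "AE z in M. u z = (c\<^sup>2 - (cmod (z - w))\<^sup>2) * ?I z"
    using ff gg
  proof eventually_elim
    case (elim z)
    have "u z = c\<^sup>2 * ?I z - cmod (z - w) * cmod (z - w) * ?I z"
      unfolding u_def elim(2) unfolding elim(1) norm_mult complex_mod_cnj norm_of_real by simp
    then show ?case by (simp add: left_diff_distrib power2_eq_square)
  qed
  have int_u: "integrable M u" unfolding u_def using integrable_fib by auto
  have pos: "0 < c\<^sup>2 - (cmod (z - w))\<^sup>2" if "z \<in> T" for z
  proof -
    have "cmod (z - w) < c" using T(2) that by (auto simp: dist_norm norm_minus_commute)
    then show ?thesis using power_strict_mono[of "cmod (z - w)" c 2] by simp
  qed
  have u_nonneg: "AE z in M. 0 \<le> u z"
    using u by eventually_elim (use pos in \<open>auto simp: indicator_def less_imp_le\<close>)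
  have "integral\<^sup>L M u = c\<^sup>2 * (norm f)\<^sup>2 - (norm ?g)\<^sup>2"
    unfolding u_def norm_eq_integral using integrable_fib by (subst Bochner_Integration.integral_diff) auto
  also have "\<dots> \<le> 0"
    using power_mono[OF below[of f], of 2] c by (simp add: power_mult_distrib)
  finally have "integral\<^sup>L M u = 0"
    using integral_nonneg_AE[OF u_nonneg] by linarith
  then have "AE z in M. u z = 0"
    using integral_nonneg_eq_0_iff_AE[OF int_u u_nonneg] by simp
  with u have "AE z in M. z \<in> E j \<longrightarrow> z \<notin> T"
    by eventually_elim (use pos in \<open>fastforce simp: indicator_def\<close>)
  then have "AE z in \<mu> j. z \<notin> T" by (simp add: AE_mu_iff[OF j])
  then show "emeasure (\<mu> j) T = 0"
    using T(1) j by (subst (asm) AE_iff_measurable[of T]) (auto simp: sets_mu sets_eq_imp_space_eq[OF sets_mu])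
qed simp

lemma not_in_spectrum_if_ball_null:
  assumes e: "e > 0" and null: "\<And>j. 1 \<le> j \<Longrightarrow> emeasure (\<mu> j) (ball w e) = 0"
  shows "w \<notin> spectrum A"
proof -
  \<comment> \<open>The resolvent multiplier, set to 0 on the null ball so that it is bounded by
    \<open>1 / e\<close>; the change is invisible almost everywhere.\<close>
  define m where "m z = (if z \<in> ball w e then 0 else 1 / (z - w))" for z
  have "ball w e \<in> sets borel" by simp
  then have m: "m \<in> borel_measurable borel" unfolding m_def by measurable
  have C: "cmod (m z) \<le> 1 / e" for z
    using e by (auto simp: m_def norm_divide dist_norm norm_minus_commute intro!: divide_left_mono mult_pos_pos)
  obtain B where B: "bounded_clinear B" "\<And>f. dsum_eq \<mu> (U (B f)) (\<lambda>j z. m z *\<^sub>C U f j z)"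
    using ex_multiplication[OF m C] by blast
  have ae: "AE z in \<mu> j. z \<notin> ball w e" if j: "1 \<le> j" for j
    using null[OF j] j by (intro AE_I[of _ _ "ball w e"]) (auto simp: sets_mu)
  have "B (A f - w *\<^sub>C f) = f" for f
  proof (rule U_inj, unfold dsum_eq_def, intro allI impI)
    fix j :: enat assume j: "1 \<le> j"
    show "AE z in \<mu> j. U (B (A f - w *\<^sub>C f)) j z = U f j z"
      using B(2)[of "A f - w *\<^sub>C f", unfolded dsum_eq_def, rule_format, OF j] ae[OF j]
        U_A_diff[of f w, unfolded dsum_eq_def, rule_format, OF j]
      by eventually_elim (use e in \<open>auto simp: m_def scaleC_scaleC\<close>)
  qed
  moreover have "A (B f) - w *\<^sub>C B f = f" for f
  proof (rule U_inj, unfold dsum_eq_def, intro allI impI)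
    fix j :: enat assume j: "1 \<le> j"
    show "AE z in \<mu> j. U (A (B f) - w *\<^sub>C B f) j z = U f j z"
      using B(2)[of f, unfolded dsum_eq_def, rule_format, OF j] ae[OF j]
        U_A_diff[of "B f" w, unfolded dsum_eq_def, rule_format, OF j]
      by eventually_elim (use e in \<open>auto simp: m_def scaleC_scaleC\<close>)
  qed
  ultimately show ?thesis unfolding spectrum_def using B(1) by blast
qed

text \<open>A bounded inverse makes \<open>A - w\<close> bounded below; the constant, the reciprocal
  of a bound for the inverse, is the radius of the null ball.\<close>

lemma ball_null_if_not_in_spectrum:
  assumes "w \<notin> spectrum A"
  obtains e where "e > 0" "\<And>j. 1 \<le> j \<Longrightarrow> emeasure (\<mu> j) (ball w e) = 0"
proof -
  obtain B where B: "bounded_clinear B" "\<And>x. B (A x - w *\<^sub>C x) = x"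
    using assms unfolding spectrum_def by blast
  obtain K where K: "K > 0" "\<And>x. norm (B x) \<le> norm x * K"
    using B(1) bounded_linear.pos_bounded unfolding bounded_clinear_def by blast
  have "1 / K * norm f \<le> norm (A f - w *\<^sub>C f)" for f
    using K(2)[of "A f - w *\<^sub>C f"] K(1) B(2)[of f] by (simp add: field_simps)
  then show thesis using emeasure_ball_eq_0[of "1 / K" w] K(1) that[of "1 / K"] by simp
qed

text \<open>Points off the spectrum are exactly those with a ball that is null for all
  \<open>\<mu> j\<close> at once. The complement is therefore open and, by Lindelof, a countable
  union of null balls.\<close>

lemma spectrum_null: "1 \<le> j \<Longrightarrow> emeasure (\<mu> j) (- spectrum A) = 0"
  and closed_spectrum: "closed (spectrum A)"
proof -
  define \<F> where "\<F> = {ball w e | w e. e > 0 \<and> (\<forall>j\<ge>1. emeasure (\<mu> j) (ball w e) = 0)}"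
  have eq: "- spectrum A = \<Union>\<F>"
  proof (intro equalityI subsetI)
    fix w assume "w \<in> - spectrum A"
    then obtain e where "e > 0" "\<And>j. 1 \<le> j \<Longrightarrow> emeasure (\<mu> j) (ball w e) = 0"
      using ball_null_if_not_in_spectrum by blast
    then have "ball w e \<in> \<F>" "w \<in> ball w e" unfolding \<F>_def by auto
    then show "w \<in> \<Union>\<F>" by blast
  next
    fix v assume "v \<in> \<Union>\<F>"
    then obtain w e where we: "v \<in> ball w e" "\<And>j. 1 \<le> j \<Longrightarrow> emeasure (\<mu> j) (ball w e) = 0"
      unfolding \<F>_def by blast
    obtain d where d: "d > 0" "ball v d \<subseteq> ball w e" using openE[OF open_ball we(1)] by blast
    have "emeasure (\<mu> j) (ball v d) = 0" if j: "1 \<le> j" for j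
      using emeasure_mono[OF d(2), of "\<mu> j"] we(2)[OF j] j by (simp add: sets_mu)
    then show "v \<in> - spectrum A" using not_in_spectrum_if_ball_null[OF d(1)] by blast
  qed
  show "closed (spectrum A)"
    unfolding closed_def eq by (auto simp: \<F>_def)
  obtain \<F>' where \<F>': "\<F>' \<subseteq> \<F>" "countable \<F>'" "\<Union>\<F>' = \<Union>\<F>"
    using Lindelof[of \<F>] unfolding \<F>_def by blast
  assume j: "1 \<le> j"
  have "(\<Union>S\<in>\<F>'. S) \<in> null_sets (\<mu> j)"
    using \<F>'(1) j by (intro null_sets_UN'[OF \<F>'(2)]) (auto simp: \<F>_def null_sets_def sets_mu)
  then show "emeasure (\<mu> j) (- spectrum A) = 0" using eq \<F>'(3) by auto
qed

lemma AE_in_spectrum: "AE z in M. z \<in> spectrum A"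
proof -
  have "AE z in \<mu> j. z \<in> spectrum A" if "1 \<le> j" for j
    using spectrum_null[OF that] closed_spectrum that
    by (intro AE_I[of _ _ "- spectrum A"]) (auto simp: sets_mu)
  then have "AE z in M. \<exists>j\<ge>1. z \<in> E j \<and> z \<in> spectrum A" by (rule AE_sum_measureI)
  then show ?thesis by eventually_elim auto
qed

text \<open>For \<open>w\<close> of modulus beyond a bound for \<open>A\<close>, the operator
  \<open>A - w\<close> is bounded below by the excess, so a ball around \<open>w\<close> is null.
  The normalization \<open>K \<ge> 1\<close> makes \<open>ln K\<close> nonnegative.\<close>

lemma spectrum_bounded:
  obtains K where "K \<ge> 1" "\<And>z. z \<in> spectrum A \<Longrightarrow> cmod z \<le> K"
proof -
  obtain K where K: "K > 0" "\<And>x. norm (A x) \<le> norm x * K"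
    using A bounded_linear.pos_bounded unfolding bounded_clinear_def by blast
  have "cmod w \<le> K" if w: "w \<in> spectrum A" for w
  proof (rule ccontr)
    assume "\<not> cmod w \<le> K"
    then have c: "cmod w - K > 0" by simp
    have "(cmod w - K) * norm f \<le> norm (A f - w *\<^sub>C f)" for f
      using norm_triangle_ineq2[of "w *\<^sub>C f" "A f"] K(2)[of f]
      by (simp add: norm_scaleC norm_minus_commute algebra_simps)
    then have "emeasure (\<mu> j) (ball w (cmod w - K)) = 0" if "1 \<le> j" for j
      using emeasure_ball_eq_0[OF c _ that] by blast
    then show False using not_in_spectrum_if_ball_null[OF c] w by blast
  qed
  then show thesis using that[of "max 1 K"] by fastforce
qed

end

section \<open>Powers and completeness\<close>

lemma borel_measurable_Arg [measurable]: "Arg \<in> borel_measurable borel"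
proof -
  \<comment> \<open>\<open>Arg\<close> is continuous off the nonpositive real axis, constantly
    \<open>pi\<close> on its nonzero part, and 0 at 0.\<close>
  have "(\<lambda>z. indicator (- \<real>\<^sub>\<le>\<^sub>0) z *\<^sub>R Arg z + indicator (\<real>\<^sub>\<le>\<^sub>0 - {0}) z *\<^sub>R pi) \<in> borel_measurable borel"
  proof (rule borel_measurable_add)
    show "(\<lambda>z. indicator (- \<real>\<^sub>\<le>\<^sub>0) z *\<^sub>R Arg z) \<in> borel_measurable borel"
      by (rule borel_measurable_continuous_on_indicator[OF _ continuous_on_Arg])
        (simp add: borel_closed)
    have "\<real>\<^sub>\<le>\<^sub>0 - {0 :: complex} \<in> sets borel" by (simp add: borel_closed)
    then show "(\<lambda>z. indicator (\<real>\<^sub>\<le>\<^sub>0 - {0}) z *\<^sub>R pi) \<in> borel_measurable (borel :: complex measure)"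
      by measurable
  qed
  also have "(\<lambda>z. indicator (- \<real>\<^sub>\<le>\<^sub>0) z *\<^sub>R Arg z + indicator (\<real>\<^sub>\<le>\<^sub>0 - {0}) z *\<^sub>R pi) = Arg"
  proof
    fix z
    show "indicator (- \<real>\<^sub>\<le>\<^sub>0) z *\<^sub>R Arg z + indicator (\<real>\<^sub>\<le>\<^sub>0 - {0}) z *\<^sub>R pi = Arg z"
    proof (cases "z \<in> \<real>\<^sub>\<le>\<^sub>0 - {0}")
      case True
      then have "Re z < 0" "Im z = 0" by (auto simp: complex_nonpos_Reals_iff complex_eq_iff)
      then have "Arg z = pi" by (simp add: Arg_eq_pi)
      then show ?thesis using True by simp
    qed (auto simp: indicator_def Arg_zero)
  qed
  finally show ?thesis .
qed

definition log_branch :: "complex \<Rightarrow> complex" where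
  "log_branch z = Complex (ln (cmod z)) (arg_branch z)"

lemma zpow_eq: "z \<noteq> 0 \<Longrightarrow> zpow z t = exp (complex_of_real t * log_branch z)"
  by (simp add: zpow_def log_branch_def)

lemma log_branch_measurable [measurable]: "log_branch \<in> borel_measurable borel"
  unfolding log_branch_def Complex_eq arg_branch_def by measurable

lemma zpow_measurable [measurable]: "(\<lambda>z. zpow z t) \<in> borel_measurable borel"
  unfolding zpow_def log_branch_def[symmetric] by measurable

lemma exp_log_branch:
  assumes "z \<noteq> 0"
  shows "exp (log_branch z) = z"
proof -
  have "exp (\<i> * complex_of_real (arg_branch z)) = exp (\<i> * complex_of_real (Arg z))"
    by (simp add: arg_branch_def exp_minus)
  then show ?thesis
    using assms Arg_eq[OF assms] by (simp add: log_branch_def Complex_eq exp_add exp_of_real)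
qed

lemma zpow_of_nat: "zpow z (real n) = z ^ n"
proof (cases "z = 0")
  case False
  then show ?thesis using exp_of_nat_mult[of n "log_branch z"] by (simp add: zpow_eq exp_log_branch)
qed (simp add: zpow_def)

lemma Im_log_branch: "\<bar>Im (log_branch z)\<bar> \<le> pi"
  using Arg_bounded[of z] by (auto simp: log_branch_def arg_branch_def abs_le_iff)

lemma Re_log_branch_le:
  assumes "z \<noteq> 0" "cmod z \<le> K"
  shows "Re (log_branch z) \<le> ln K"
  using assms ln_mono[of "cmod z" K] by (simp add: log_branch_def)

lemma norm_zpow_le:
  assumes t: "0 \<le> t" and K: "1 \<le> K" "cmod z \<le> K"
  shows "cmod (zpow z t) \<le> exp (t * ln K)"
proof (cases "z = 0")
  case True
  then show ?thesis using t K by (simp add: zpow_def)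
next
  case False
  then show ?thesis using Re_log_branch_le[OF False K(2)] t by (simp add: zpow_eq mult_left_mono)
qed

text \<open>Tonelli makes the series of the \<open>f n\<close> finite almost everywhere, so its
  terms tend to 0 along the whole sequence, without passing to a subsequence.\<close>

lemma AE_tendsto_0_if_summable_integral:
  fixes f :: "nat \<Rightarrow> 'a \<Rightarrow> real"
  assumes int: "\<And>n. integrable M (f n)" and nonneg: "\<And>n x. 0 \<le> f n x"
    and summ: "summable (\<lambda>n. LINT x|M. f n x)"
  shows "AE x in M. (\<lambda>n. f n x) \<longlonglongrightarrow> 0"
proof -
  have "(\<integral>\<^sup>+x. (\<Sum>n. ennreal (f n x)) \<partial>M) = (\<Sum>n. \<integral>\<^sup>+x. ennreal (f n x) \<partial>M)"
    using int by (intro nn_integral_suminf) auto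
  also have "\<dots> = (\<Sum>n. ennreal (LINT x|M. f n x))"
    using int nonneg by (intro suminf_cong nn_integral_eq_integral) auto
  also have "\<dots> \<noteq> \<infinity>"
    using summ nonneg by (simp add: ennreal_suminf_neq_top)
  finally have "AE x in M. (\<Sum>n. ennreal (f n x)) \<noteq> \<infinity>"
    using int by (intro nn_integral_PInf_AE) auto
  then show ?thesis
  proof eventually_elim
    case (elim x)
    then have "summable (\<lambda>n. f n x)" using nonneg by (intro summable_suminf_not_top) auto
    then show ?case by (rule summable_LIMSEQ_zero)
  qed
qed

context spectral_model
begin

section \<open>Powers as multiplication operators\<close>

lemma power_multiplier_bounded:
  assumes t: "0 \<le> t"
  obtains C where "\<And>z. cmod (indicator (spectrum A) z * zpow z t) \<le> C"
proof -
  obtain K where K: "K \<ge> 1" "\<And>z. z \<in> spectrum A \<Longrightarrow> cmod z \<le> K" using spectrum_bounded by blast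
  have "cmod (indicator (spectrum A) z * zpow z t) \<le> exp (t * ln K)" for z
    using norm_zpow_le[OF t K(1) K(2)[of z]] by (cases "z \<in> spectrum A") auto
  then show thesis using that by blast
qed

lemma power_multiplier_measurable:
  "(\<lambda>z. indicator (spectrum A) z * zpow z t) \<in> borel_measurable borel"
proof -
  have [measurable]: "spectrum A \<in> sets borel" using closed_spectrum by (rule borel_closed)
  show ?thesis by measurable
qed

lemma cinner_multiplication:
  assumes "dsum_eq \<mu> (U g) (\<lambda>j z. m z *\<^sub>C U f j z)" "m \<in> borel_measurable borel"
  shows "cinner g h = (LINT z|M. m z * fib f h z)"
  unfolding integral_fib[symmetric]
  by (rule integral_cong_AE) (use AE_fib_scaleC_left[OF assms(1)] fib_measurable assms(2) in auto)

text \<open>Shows that the \<open>THE\<close> in \<open>operator_power\<close> denotes: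
  multiplication by the power satisfies the defining formula, and an operator is determined by its
  sesquilinear form. The indicator keeps the multiplier bounded.\<close>

lemma operator_power_model:
  assumes t: "0 \<le> t"
  shows "dsum_eq \<mu> (U (operator_power A \<mu> E U t f)) (\<lambda>j z. (indicator (spectrum A) z * zpow z t) *\<^sub>C U f j z)"
proof -
  let ?m = "\<lambda>z. indicator (spectrum A) z * zpow z t"
  obtain C where C: "\<And>z. cmod (?m z) \<le> C" using power_multiplier_bounded[OF t] by blast
  obtain B where B: "bounded_clinear B" "\<And>f. dsum_eq \<mu> (U (B f)) (\<lambda>j z. ?m z *\<^sub>C U f j z)"
    using ex_multiplication[OF power_multiplier_measurable C] by blast
  have eq: "cinner (B f) h = (LINT z:spectrum A|M. zpow z t * fib f h z)" for f h
  proof -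
    have "cinner (B f) h = (LINT z|M. ?m z * fib f h z)"
      by (rule cinner_multiplication[OF B(2) power_multiplier_measurable])
    also have "\<dots> = (LINT z:spectrum A|M. zpow z t * fib f h z)"
      unfolding set_lebesgue_integral_def
      by (intro Bochner_Integration.integral_cong) (auto simp: indicator_def)
    finally show ?thesis .
  qed
  have "operator_power A \<mu> E U t = B"
    unfolding operator_power_def
  proof (rule the_equality)
    show "bounded_clinear B \<and> (\<forall>f\<^sub>1 f\<^sub>2. cinner (B f\<^sub>1) f\<^sub>2 = (LINT z:spectrum A|M. zpow z t * fib f\<^sub>1 f\<^sub>2 z))"
      using B(1) eq by blast
    fix B' assume "bounded_clinear B' \<and> (\<forall>f\<^sub>1 f\<^sub>2. cinner (B' f\<^sub>1) f\<^sub>2 = (LINT z:spectrum A|M. zpow z t * fib f\<^sub>1 f\<^sub>2 z))"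
    then have "cinner (B' f) h = cinner (B f) h" for f h by (simp add: eq)
    then have "cinner (B' f - B f) (B' f - B f) = 0" for f by (simp add: cinner_diff_left)
    then show "B' = B" by (auto simp: cinner_self fun_eq_iff)
  qed
  then show ?thesis using B(2) by simp
qed

section \<open>From complete orbits to complete fibres\<close>

lemma AE_U_in_cspan:
  assumes "s \<in> cspan {operator_power A \<mu> E U t g | g t. g \<in> G \<and> t \<in> {0..L}}" and j: "1 \<le> j"
  shows "AE z in \<mu> j. U s j z \<in> cspan {U g j z | g. g \<in> G}"
  using assms(1)
proof (induction rule: complex_vector.span_induct_alt)
  case base
  show ?case using U_zero[unfolded dsum_eq_def, rule_format, OF j]
    by eventually_elim (simp add: complex_vector.span_zero)
next
  case (step c x y)
  then obtain g t where x: "x = operator_power A \<mu> E U t g" "g \<in> G" "0 \<le> t" by auto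
  show ?case
    using step(2) operator_power_model[OF x(3), of g, unfolded dsum_eq_def, rule_format, OF j]
      U_add[of "c *\<^sub>C x" y, unfolded dsum_eq_def, rule_format, OF j]
      U_scaleC[of c x, unfolded dsum_eq_def, rule_format, OF j]
  proof eventually_elim
    case (elim z)
    \<comment> \<open>The power acts on the fibre over \<open>z\<close> as a scalar, so the time
      parameter disappears and only the vectors \<open>U g j z\<close> matter.\<close>
    have "U g j z \<in> cspan {U g j z | g. g \<in> G}" using x(2) by (intro complex_vector.span_base) blast
    then show ?case unfolding elim(3) elim(4)
      by (intro complex_vector.span_add complex_vector.span_scale elim(1))
        (simp add: x(1) elim(2) complex_vector.span_scale)
  qed
qed

lemma AE_U_in_closure_cspan:
  assumes f: "f \<in> closure (cspan {operator_power A \<mu> E U t g | g t. g \<in> G \<and> t \<in> {0..L}})"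
    and j: "1 \<le> j"
  shows "AE z in \<mu> j. U f j z \<in> closure (cspan {U g j z | g. g \<in> G})"
proof -
  define S where "S = cspan {operator_power A \<mu> E U t g | g t. g \<in> G \<and> t \<in> {0..L}}"
  \<comment> \<open>Squared, this rate becomes \<open>(1/4) ^ n\<close>, the geometric series that
    dominates the integrals below.\<close>
  have "\<exists>s\<in>S. norm (f - s) < (1/2) ^ n" for n
    using f[folded S_def, unfolded closure_approachable, rule_format, of "(1/2) ^ n"]
    by (auto simp: dist_norm norm_minus_commute)
  then obtain s where s: "\<And>n. s n \<in> S" "\<And>n. norm (f - s n) < (1/2) ^ n" by metis
  let ?d = "\<lambda>n z. cmod (fib (f - s n) (f - s n) z)"
  have "AE z in M. (\<lambda>n. ?d n z) \<longlonglongrightarrow> 0"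
  proof (rule AE_tendsto_0_if_summable_integral)
    show "summable (\<lambda>n. LINT z|M. ?d n z)"
    proof (rule summable_comparison_test')
      show "summable (\<lambda>n. (1/4 :: real) ^ n)" by (rule summable_geometric) simp
      show "norm (LINT z|M. ?d n z) \<le> (1/4) ^ n" for n
      proof -
        have "(norm (f - s n))\<^sup>2 \<le> ((1/2) ^ n)\<^sup>2"
          by (rule power_mono[OF less_imp_le[OF s(2)]]) simp
        also have "\<dots> = ((1/2)\<^sup>2) ^ n" by (simp only: power_mult[symmetric] mult.commute)
        also have "\<dots> = (1/4 :: real) ^ n" by (simp add: power2_eq_square)
        finally show ?thesis by (simp add: norm_eq_integral[symmetric])
      qed
    qed
  qed (use integrable_fib in auto)
  then have "AE z in \<mu> j. (\<lambda>n. ?d n z) \<longlonglongrightarrow> 0" by (auto simp: AE_mu_iff[OF j])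
  moreover have "AE z in \<mu> j. \<forall>n. U (f - s n) j z = U f j z - U (s n) j z"
    unfolding AE_all_countable using U_diff[unfolded dsum_eq_def, rule_format, OF j] by blast
  moreover have "AE z in \<mu> j. \<forall>n. U (s n) j z \<in> cspan {U g j z | g. g \<in> G}"
    unfolding AE_all_countable using AE_U_in_cspan[OF s(1)[unfolded S_def] j] by blast
  ultimately show ?thesis using AE_in_E[OF j]
  proof eventually_elim
    case (elim z)
    have "?d n z = (norm (U f j z - U (s n) j z))\<^sup>2" for n
      using elim(2,4) by (simp add: fibre_cinner_eq[OF disj j] cinner_self norm_power)
    then have "(\<lambda>n. (norm (U f j z - U (s n) j z))\<^sup>2) \<longlonglongrightarrow> 0" using elim(1) by simp
    then have "(\<lambda>n. sqrt ((norm (U f j z - U (s n) j z))\<^sup>2)) \<longlonglongrightarrow> sqrt 0" by (intro tendsto_intros)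
    then have "(\<lambda>n. norm (U (s n) j z - U f j z)) \<longlonglongrightarrow> 0" by (simp add: norm_minus_commute)
    then have "(\<lambda>n. U (s n) j z) \<longlonglongrightarrow> U f j z" by (simp add: LIM_zero_iff tendsto_norm_zero_iff)
    then show ?case unfolding closure_sequential
      using elim(3) by (intro exI[of _ "\<lambda>n. U (s n) j z"]) simp
  qed
qed

lemma complete_fibre_iff:
  assumes "1 \<le> j"
  shows "complete_system {U g j z | g. g \<in> G} (ell2_on (Omega j)) \<longleftrightarrow>
    ell2_on (Omega j) \<subseteq> closure (cspan {U g j z | g. g \<in> G})"
  using dsum_L2_ell2_on[OF U_mem assms]
  by (intro complete_system_iff csubspace_ell2_on closed_ell2_on) auto

lemma complete_fibres_if_complete:
  assumes complete: "complete_system {operator_power A \<mu> E U t g | g t. g \<in> G \<and> t \<in> {0..L}} UNIV"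
    and j: "1 \<le> j"
  shows "AE z in \<mu> j. complete_system {U g j z | g. g \<in> G} (ell2_on (Omega j))"
proof -
  let ?V = "\<lambda>z. cspan {U g j z | g. g \<in> G}"
  interpret sigma_finite_measure "\<mu> j" using sigma_finite_mu[OF j] .
  obtain B :: "nat \<Rightarrow> complex set" where B: "range B \<subseteq> sets (\<mu> j)" "(\<Union>i. B i) = space (\<mu> j)" "\<And>i. emeasure (\<mu> j) (B i) \<noteq> \<infinity>"
    using sigma_finite by metis
  have sp: "space (\<mu> j) = UNIV" using sets_eq_imp_space_eq[OF sets_mu[OF j]] by simp
  \<comment> \<open>Both indices \<open>i\<close> and \<open>k\<close> are countable and the
    \<open>B i\<close> cover the plane, so a single null set will work for all unit vectors.\<close>
  have "AE z in \<mu> j. z \<in> B i \<longrightarrow> k \<in> Omega j \<longrightarrow> unit_ell2 k \<in> closure (?V z)" for i k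
  proof (cases "k \<in> Omega j")
    case True
    have "B i \<in> sets borel" using B(1) j by (auto simp: sets_mu)
    moreover have "emeasure (\<mu> j) (B i) < \<infinity>" using B(3)[of i] by (simp add: top.not_eq_extremum)
    ultimately have "(\<lambda>l z. if l = j \<and> z \<in> B i then unit_ell2 k else 0) \<in> dsum_L2 \<mu>"
      by (intro dsum_L2_unit j True)
    then obtain f where f: "dsum_eq \<mu> (U f) (\<lambda>l z. if l = j \<and> z \<in> B i then unit_ell2 k else 0)"
      using U_surj by blast
    have "AE z in \<mu> j. U f j z \<in> closure (?V z)"
      using complete unfolding complete_system_def by (intro AE_U_in_closure_cspan[OF _ j]) auto
    then show ?thesis using f[unfolded dsum_eq_def, rule_format, OF j]
      by eventually_elim auto
  qed simp
  then have "AE z in \<mu> j. \<forall>i k. z \<in> B i \<longrightarrow> k \<in> Omega j \<longrightarrow> unit_ell2 k \<in> closure (?V z)"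
    unfolding AE_all_countable by blast
  then show ?thesis
  proof eventually_elim
    case (elim z)
    have "z \<in> (\<Union>i. B i)" using B(2) sp by simp
    then have "ell2_on (Omega j) \<subseteq> closure (?V z)"
      using elim by (intro ell2_on_subset_closure complex_vector.subspace_span) blast
    then show ?case using complete_fibre_iff[OF j] by blast
  qed
qed

section \<open>From complete fibres to complete orbits\<close>

lemma dsum_eq_funpow: "dsum_eq \<mu> (U ((A ^^ n) f)) (\<lambda>j z. z ^ n *\<^sub>C U f j z)"
  unfolding dsum_eq_def
proof (intro allI impI)
  fix j :: enat assume j: "1 \<le> j"
  show "AE z in \<mu> j. U ((A ^^ n) f) j z = z ^ n *\<^sub>C U f j z"
  proof (induction n)
    case 0
    then show ?case by simp
  next
    case (Suc n)
    show ?case using Suc U_A[of "(A ^^ n) f", unfolded dsum_eq_def, rule_format, OF j]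
      by eventually_elim (simp add: scaleC_scaleC)
  qed
qed

lemma cinner_funpow: "cinner ((A ^^ n) g) ((A ^^ m) f) = (LINT z|M. z ^ n * cnj z ^ m * fib g f z)"
  unfolding integral_fib[symmetric]
proof (rule integral_cong_AE)
  show "AE z in M. fib ((A ^^ n) g) ((A ^^ m) f) z = z ^ n * cnj z ^ m * fib g f z"
    using AE_fib_scaleC[OF dsum_eq_funpow dsum_eq_funpow] by (simp add: complex_cnj_power)
  show "(\<lambda>z. z ^ n * cnj z ^ m * fib g f z) \<in> borel_measurable M"
    using fib_measurable by auto
qed (use fib_measurable in auto)

lemma cinner_operator_power:
  assumes "0 \<le> t"
  shows "cinner (operator_power A \<mu> E U t g) f = (LINT z|M. indicator (spectrum A) z * zpow z t * fib g f z)"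
  by (rule cinner_multiplication[OF operator_power_model[OF assms] power_multiplier_measurable])

lemma cinner_funpow_eq_0:
  assumes L: "0 < L" and zero: "\<And>t. 0 \<le> t \<Longrightarrow> t \<le> L \<Longrightarrow> cinner (operator_power A \<mu> E U t g) f = 0"
  shows "cinner ((A ^^ n) g) f = 0"
proof -
  have [measurable]: "spectrum A \<in> sets borel" using closed_spectrum by (rule borel_closed)
  have fib_m [measurable]: "fib g f \<in> borel_measurable borel" by (rule fib_measurable)
  obtain K where K: "K \<ge> 1" "\<And>z. z \<in> spectrum A \<Longrightarrow> cmod z \<le> K" using spectrum_bounded by blast
  \<comment> \<open>For \<open>t > 0\<close> the point 0 contributes nothing, since
    \<open>zpow 0 t = 0\<close>, and off 0 a logarithm exists. The exponent \<open>t = 0\<close>,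
    where an atom at 0 does count, is covered below by the hypothesis at that very time.\<close>
  define S where "S = spectrum A - {0}"
  have S [measurable]: "S \<in> sets borel" unfolding S_def by measurable
  \<comment> \<open>Off \<open>S\<close> the exponent is set to 0, so the bounds on \<open>w\<close>
    hold everywhere; \<open>H\<close> vanishes there, so the integrals are unaffected.\<close>
  define w where "w z = indicator S z *\<^sub>R log_branch z" for z
  define H where "H z = indicator S z *\<^sub>R fib g f z" for z
  have H: "integrable M H" unfolding H_def
    by (rule integrable_mult_indicator) (use S integrable_fib in \<open>auto simp: sets_sum_measure\<close>)
  have "w \<in> borel_measurable borel" unfolding w_def by measurable
  then have w: "w \<in> borel_measurable M" by simp
  have Re_w: "Re (w z) \<le> ln K" for z
    using Re_log_branch_le[of z K] K by (auto simp: w_def S_def indicator_def)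
  have Im_w: "\<bar>Im (w z)\<bar> \<le> pi" for z
    using Im_log_branch[of z] by (auto simp: w_def indicator_def)
  have eq: "indicator (spectrum A) z * zpow z t * fib g f z = exp (complex_of_real t * w z) * H z" if "t > 0" for t z
  proof (cases "z = 0")
    case True
    then show ?thesis using that by (simp add: H_def S_def zpow_def)
  qed (auto simp: w_def H_def S_def zpow_eq indicator_def)
  have "(LINT z|M. exp (complex_of_real t * w z) * H z) = 0" if "0 < t" for t
  proof (rule exp_integral_eq_0[OF H w Re_w Im_w _ L _ that])
    show "0 \<le> ln K" using K(1) by simp
    fix t assume "0 < t" "t < L"
    then show "(LINT z|M. exp (complex_of_real t * w z) * H z) = 0"
      using zero[of t] cinner_operator_power[of t g f] eq[of t] by simp
  qed
  then have "(LINT z|M. indicator (spectrum A) z * zpow z t * fib g f z) = 0" if "0 \<le> t" for t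
    using zero[of 0] cinner_operator_power[of 0 g f] L eq[of t] that by (cases "t = 0") auto
  then have "(LINT z|M. indicator (spectrum A) z * zpow z (real n) * fib g f z) = 0" by simp
  \<comment> \<open>At an integer exponent the branch of the argument is immaterial, and
    \<open>M\<close> is carried by the spectrum, so the integral belongs to the iterate
    \<open>A ^^ n\<close>.\<close>
  moreover have "(LINT z|M. indicator (spectrum A) z * zpow z (real n) * fib g f z) = cinner ((A ^^ n) g) f"
  proof -
    have "cinner ((A ^^ n) g) f = (LINT z|M. z ^ n * fib g f z)"
      by (rule cinner_multiplication[OF dsum_eq_funpow]) measurable
    also have "\<dots> = (LINT z|M. indicator (spectrum A) z * zpow z (real n) * fib g f z)"
    proof (rule integral_cong_AE)
      show "AE z in M. z ^ n * fib g f z = indicator (spectrum A) z * zpow z (real n) * fib g f z"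
        using AE_in_spectrum by eventually_elim (simp add: zpow_of_nat)
    qed (use power_multiplier_measurable[of "real n"] in auto)
    finally show ?thesis by simp
  qed
  ultimately show ?thesis by simp
qed

lemma complete_if_complete_fibres:
  assumes red: "reductive A" and G: "countable G" and L: "0 < L"
    and fibres: "\<And>j. 1 \<le> j \<Longrightarrow> AE z in \<mu> j. complete_system {U g j z | g. g \<in> G} (ell2_on (Omega j))"
  shows "complete_system {operator_power A \<mu> E U t g | g t. g \<in> G \<and> t \<in> {0..L}} UNIV"
proof (rule complete_systemI_orthogonal)
  fix f assume orth: "\<And>s. s \<in> {operator_power A \<mu> E U t g | g t. g \<in> G \<and> t \<in> {0..L}} \<Longrightarrow> cinner s f = 0"
  have fA: "cinner ((A ^^ n) g) f = 0" if "g \<in> G" for g n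
    by (rule cinner_funpow_eq_0[OF L]) (use orth that in auto)
  define S where "S = {(A ^^ n) g | n g. g \<in> G}"
  define V where "V = closure (cspan S)"
  have linA: "bounded_linear A" "\<And>c x. A (c *\<^sub>C x) = c *\<^sub>C A x"
    using A by (auto simp: bounded_clinear_def)
  have addA: "A (x + y) = A x + A y" for x y
    using linA(1) by (simp add: bounded_linear.linear linear_add)
  have A_span: "A x \<in> cspan S" if "x \<in> cspan S" for x
    using that
  proof (induction rule: complex_vector.span_induct_alt)
    case base
    show ?case using linA(1) by (simp add: bounded_linear.linear linear_0 complex_vector.span_zero)
  next
    case (step c x y)
    then obtain n g where "x = (A ^^ n) g" "g \<in> G" by (auto simp: S_def)
    then have "A x = (A ^^ Suc n) g" "g \<in> G" by auto
    then have "A x \<in> S" unfolding S_def by blast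
    then show ?case using step(2)
      by (simp add: addA linA(2) complex_vector.span_add complex_vector.span_scale complex_vector.span_base)
  qed
  have "invariant_subspace A V"
    unfolding invariant_subspace_def V_def
    using bounded_linear_image_closure[OF linA(1) A_span]
    by (auto intro: csubspace_closure)
  then have inv: "invariant_subspace A (orth_complement V)"
    using red unfolding reductive_def reducing_subspace_def V_def by auto
  have "f \<in> orth_complement V"
    unfolding orth_complement_def
  proof (intro CollectI ballI)
    fix v assume "v \<in> V"
    then have "cinner v f = 0" unfolding V_def
      by (intro cinner_eq_0_closure_cspan[of S f v]) (auto simp: S_def fA)
    then show "cinner f v = 0" by (simp add: cinner_eq_zero_sym)
  qed
  then have fm: "(A ^^ m) f \<in> orth_complement V" for m
    using inv by (induction m) (auto simp: invariant_subspace_def)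
  have moments: "(LINT z|M. z ^ n * cnj z ^ m * fib g f z) = 0" if "g \<in> G" for g n m
  proof -
    have "(A ^^ n) g \<in> S" using that unfolding S_def by blast
    then have "(A ^^ n) g \<in> V"
      unfolding V_def using closure_subset[of "cspan S"] complex_vector.span_base[of "(A ^^ n) g" S] by blast
    then have "cinner ((A ^^ n) g) ((A ^^ m) f) = 0"
      using fm[of m] unfolding orth_complement_def by (simp add: cinner_eq_zero_sym)
    then show ?thesis by (simp add: cinner_funpow)
  qed
  obtain K where K: "K \<ge> 1" "\<And>z. z \<in> spectrum A \<Longrightarrow> cmod z \<le> K" using spectrum_bounded by blast
  have sp [measurable]: "spectrum A \<in> sets borel" using closed_spectrum by (rule borel_closed)
  have fib0: "AE z in M. fib g f z = 0" if g: "g \<in> G" for g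
  proof -
    \<comment> \<open>Cutting off outside the spectrum changes \<open>fib g f\<close> only on a null
      set and supplies the bounded support that the moment argument requires.\<close>
    define h where "h z = indicator (spectrum A) z *\<^sub>R fib g f z" for z
    have fib_m [measurable]: "fib g f \<in> borel_measurable borel" by (rule fib_measurable)
    have h_m [measurable]: "h \<in> borel_measurable borel" unfolding h_def by measurable
    have h: "AE z in M. h z = fib g f z"
      using AE_in_spectrum by eventually_elim (simp add: h_def)
    have "AE z in M. h z = 0"
    proof (rule AE_eq_0_if_moments_eq_0[where K = K])
      show "sets M = sets borel" by (rule sets_sum_measure)
      show "integrable M h" unfolding h_def
        by (rule integrable_mult_indicator) (use integrable_fib in \<open>auto simp: sets_sum_measure\<close>)
      show "cmod z \<le> K" if "h z \<noteq> 0" for z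
        using that K(2) by (auto simp: h_def indicator_def split: if_splits)
      fix n m
      have "(LINT z|M. z ^ n * cnj z ^ m * h z) = (LINT z|M. z ^ n * cnj z ^ m * fib g f z)"
        by (rule integral_cong_AE) (use h in auto)
      then show "(LINT z|M. z ^ n * cnj z ^ m * h z) = 0" using moments[OF g] by simp
    qed
    with h show ?thesis by eventually_elim simp
  qed
  have "dsum_eq \<mu> (U f) (U 0)"
    unfolding dsum_eq_def
  proof (intro allI impI)
    fix j :: enat assume j: "1 \<le> j"
    \<comment> \<open>Countability of \<open>G\<close> lets one null set serve for all
      \<open>g\<close>.\<close>
    have "AE z in M. \<forall>g\<in>G. fib g f z = 0"
      by (subst AE_ball_countable[OF G]) (use fib0 in blast)
    then have "AE z in \<mu> j. \<forall>g\<in>G. fib g f z = 0" by (auto simp: AE_mu_iff[OF j])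
    then show "AE z in \<mu> j. U f j z = U 0 j z"
      using fibres[OF j] AE_in_E[OF j] U_zero[unfolded dsum_eq_def, rule_format, OF j]
    proof eventually_elim
      case (elim z)
      \<comment> \<open>The fibre \<open>U f j z\<close> is orthogonal to a system whose closed span
        contains it, hence orthogonal to itself.\<close>
      have "cinner s (U f j z) = 0" if "s \<in> {U g j z | g. g \<in> G}" for s
        using that elim(1,3) by (auto simp: fibre_cinner_eq[OF disj j])
      moreover have "U f j z \<in> closure (cspan {U g j z | g. g \<in> G})"
        using elim(2) dsum_L2_ell2_on[OF U_mem j] by (auto simp: complete_fibre_iff[OF j])
      ultimately have "cinner (U f j z) (U f j z) = 0" by (rule cinner_eq_0_closure_cspan)
      then show ?case using elim(4) by (simp add: cinner_self)
    qed
  qed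
  then show "f = 0" by (rule U_inj)
qed

end

theorem theorem3p1:
  fixes A :: "'a::chilbert_space \<Rightarrow> 'a"
    and \<G> :: "'a set"
    and L :: real
    and \<mu> :: "enat \<Rightarrow> complex measure"
    and E :: "enat \<Rightarrow> complex set"
    and U :: "'a \<Rightarrow> enat \<Rightarrow> complex \<Rightarrow> ell2"
  assumes "separable_space (euclidean :: 'a topology)"
    and "normal_operator A"
    and "countable \<G>"
    and "0 < L"
    and "spectral_representation A \<mu> E U"
  shows "(complete_system {operator_power A \<mu> E U t g | g t. g \<in> \<G> \<and> t \<in> {0..L}} UNIV \<longrightarrow>
            (\<forall>j\<ge>1. AE z in \<mu> j. complete_system {U g j z | g. g \<in> \<G>} (ell2_on (Omega j)))) \<and>
         (reductive A \<longrightarrow>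
            (complete_system {operator_power A \<mu> E U t g | g t. g \<in> \<G> \<and> t \<in> {0..L}} UNIV \<longleftrightarrow>
              (\<forall>j\<ge>1. AE z in \<mu> j. complete_system {U g j z | g. g \<in> \<G>} (ell2_on (Omega j)))))"
proof -
  interpret spectral_model \<mu> E A U
    using assms(2) assms(5)[unfolded spectral_representation_def]
    by (intro spectral_model.intro multiplicity_measures.intro spectral_model_axioms.intro)
      (simp_all add: normal_operator_def)
  show ?thesis
  proof (intro conjI impI iffI allI)
    fix j :: enat
    assume "complete_system {operator_power A \<mu> E U t g | g t. g \<in> \<G> \<and> t \<in> {0..L}} UNIV" "1 \<le> j"
    then show "AE z in \<mu> j. complete_system {U g j z | g. g \<in> \<G>} (ell2_on (Omega j))"
      by (rule complete_fibres_if_complete)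
  next
    fix j :: enat
    assume "complete_system {operator_power A \<mu> E U t g | g t. g \<in> \<G> \<and> t \<in> {0..L}} UNIV" "1 \<le> j"
    then show "AE z in \<mu> j. complete_system {U g j z | g. g \<in> \<G>} (ell2_on (Omega j))"
      by (rule complete_fibres_if_complete)
  next
    assume "reductive A"
      and "\<forall>j\<ge>1. AE z in \<mu> j. complete_system {U g j z | g. g \<in> \<G>} (ell2_on (Omega j))"
    then show "complete_system {operator_power A \<mu> E U t g | g t. g \<in> \<G> \<and> t \<in> {0..L}} UNIV"
      by (intro complete_if_complete_fibres assms(3,4)) (assumption, simp)
  qed
qed

end
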